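(* Let $n>1$ be an integer, let $B$ be the unit ball of $\mathbf{C}^n$, and let $\varphi$ be holomorphic on $B$. Let $1<p<\infty$ and $0\le\sigma<\infty$ with $1+\sigma>\frac{n}{p}$. Then the operator $U_\varphi:B_p^\sigma(B)\to B_p^\sigma(B)$ is bounded if and only if $\|\varphi\|_{H^\infty}=\sup_{z\in B}|\varphi(z)|<\infty$.
   Context: $B=\{z\in\mathbf{C}^n:|z|<1\}$, $dv$ is Lebesgue measure on $B$ normalized by $v(B)=1$, $d\lambda(z)=(1-|z|^2)^{-n-1}dv(z)$, and $H(B)$ is the space of holomorphic functions on $B$. For $f\in H(B)$ the radial derivative is $Rf(z)=\sum_{j=1}^n z_j\frac{\partial f}{\partial z_j}(z)$. For $1<p<\infty$, $0\le\sigma<\infty$ with $1+\sigma>n/p$, the Besov-Sobolev space $B_p^\sigma(B)$ is the Banach space of $f\in H(B)$ with $$\left\{|f(0)|^p+\int_B|(1-|z|^2)^{1+\sigma}f'(z)|^p\,d\lambda(z)\right\}^{1/p}<\infty,$$ where $f'$ is the first order complex derivative (the complex gradient $(\partial f/\partial z_1,\dots,\partial f/\partial z_n)$), normed by this quantity (up to equivalence of norms). The Riemann-Stieltjes operator $U_\varphi$ with symbol $\varphi\in H(B)$ is defined for $f\in H(B)$ by $$U_\varphi f(z)=\int_0^1\varphi(tz)\,Rf(tz)\,\frac{dt}{t},\qquad z\in B.$$ *)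

theory Defs
  imports "HOL-Analysis.Analysis"
begin

text \<open>
  Functions on the unit ball \<open>B\<close> are represented by total functions on \<open>complex ^ 'n\<close>.
  All notions below depend only on the values taken on \<open>B\<close>.
\<close>

abbreviation unit_ball :: "(complex ^ 'n) set" where
  "unit_ball \<equiv> ball 0 1"

text \<open>Holomorphy in several variables: the real Frechet derivative exists and is complex linear.\<close>

definition mv_holomorphic_on :: "(complex ^ 'n \<Rightarrow> complex) \<Rightarrow> (complex ^ 'n) set \<Rightarrow> bool" where
  "mv_holomorphic_on f S \<longleftrightarrow>
     (\<forall>z\<in>S. \<exists>D. (f has_derivative D) (at z within S) \<and> (\<forall>c v. D (c *s v) = c * D v))"

definition partial_deriv :: "(complex ^ 'n \<Rightarrow> complex) \<Rightarrow> 'n \<Rightarrow> complex ^ 'n \<Rightarrow> complex" where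
  "partial_deriv f j z = deriv (\<lambda>w. f (\<chi> i. if i = j then w else z $ i)) (z $ j)"

definition complex_gradient :: "(complex ^ 'n \<Rightarrow> complex) \<Rightarrow> complex ^ 'n \<Rightarrow> complex ^ 'n" where
  "complex_gradient f z = (\<chi> j. partial_deriv f j z)"

definition radial_deriv :: "(complex ^ 'n \<Rightarrow> complex) \<Rightarrow> complex ^ 'n \<Rightarrow> complex" where
  "radial_deriv f z = (\<Sum>j\<in>UNIV. z $ j * partial_deriv f j z)"

definition ball_volume :: "(complex ^ 'n) measure" where
  "ball_volume = uniform_measure lborel unit_ball"

text \<open>
  The density \<open>(1 - |z|\<^sup>2) powr (- n - 1)\<close> is only relevant on \<open>B\<close>, since \<open>ball_volume\<close>
  vanishes off \<open>B\<close>.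
\<close>

definition invariant_measure :: "(complex ^ 'n) measure" where
  "invariant_measure =
     density ball_volume (\<lambda>z. ennreal ((1 - (norm z)\<^sup>2) powr (- real CARD('n) - 1)))"

text \<open>The \<open>p\<close>-th power of the Besov-Sobolev norm, possibly infinite.\<close>

definition besov_pow :: "real \<Rightarrow> real \<Rightarrow> (complex ^ 'n \<Rightarrow> complex) \<Rightarrow> ennreal" where
  "besov_pow p \<sigma> f =
     ennreal (norm (f 0) powr p) +
     (\<integral>\<^sup>+ z. ennreal (norm ((1 - (norm z)\<^sup>2) powr (1 + \<sigma>) *\<^sub>R complex_gradient f z) powr p)
        \<partial>invariant_measure)"

definition besov_space :: "real \<Rightarrow> real \<Rightarrow> (complex ^ 'n \<Rightarrow> complex) set" where
  "besov_space p \<sigma> = {f. mv_holomorphic_on f unit_ball \<and> besov_pow p \<sigma> f < \<infinity>}"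

definition besov_norm :: "real \<Rightarrow> real \<Rightarrow> (complex ^ 'n \<Rightarrow> complex) \<Rightarrow> real" where
  "besov_norm p \<sigma> f = enn2real (besov_pow p \<sigma> f) powr (1 / p)"

text \<open>The integrand has a removable singularity at \<open>t = 0\<close>, because \<open>R f 0 = 0\<close>.\<close>

definition riemann_stieltjes ::
  "(complex ^ 'n \<Rightarrow> complex) \<Rightarrow> (complex ^ 'n \<Rightarrow> complex) \<Rightarrow> complex ^ 'n \<Rightarrow> complex" where
  "riemann_stieltjes \<phi> f z =
     integral {0..1} (\<lambda>t. \<phi> (t *\<^sub>R z) * radial_deriv f (t *\<^sub>R z) / complex_of_real t)"

definition besov_bounded ::
  "real \<Rightarrow> real \<Rightarrow> ((complex ^ 'n \<Rightarrow> complex) \<Rightarrow> (complex ^ 'n \<Rightarrow> complex)) \<Rightarrow> bool" where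
  "besov_bounded p \<sigma> T \<longleftrightarrow>
     (\<forall>f\<in>besov_space p \<sigma>. T f \<in> besov_space p \<sigma>) \<and>
     (\<exists>C. \<forall>f\<in>besov_space p \<sigma>. besov_norm p \<sigma> (T f) \<le> C * besov_norm p \<sigma> f)"

definition Hinf_norm :: "(complex ^ 'n \<Rightarrow> complex) \<Rightarrow> ennreal" where
  "Hinf_norm \<phi> = (SUP z\<in>unit_ball. ennreal (norm (\<phi> z)))"

end

theory Submission
  imports Defs "HOL-Complex_Analysis.Complex_Analysis"
begin

text \<open>
  Write \<open>R\<close> for the radial derivative, \<open>g\<close> for the image of \<open>f\<close> under the operator and \<open>h = \<phi> R f\<close>.
  Everything rests on the identity \<open>R g = h\<close> (\<open>radial_deriv_riemann_stieltjes\<close>). The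
  Besov-Sobolev norm is, up to the value at \<open>0\<close> and with \<open>\<alpha> = (1 + \<sigma>) p - n - 1\<close>, the
  \<open>L\<^sup>p\<close> norm of the gradient for the weight \<open>(1 - |z|\<^sup>2) powr \<alpha>\<close> (\<open>besov_pow_eq\<close>), and the hypothesis \<open>1 + \<sigma> > n / p\<close> says that
  \<open>\<alpha> > - 1\<close>, so that the weight is integrable.

  If the operator is bounded, apply its powers to a coordinate function \<open>z\<^sub>i\<close>. The \<open>k\<close>-th image has
  radial derivative \<open>\<phi>\<^sup>k z\<^sub>i\<close>, so the weighted \<open>L\<^sup>p\<close> norm of \<open>\<phi>\<^sup>k z\<^sub>i\<close> grows at most like \<open>C\<^sup>k\<close>, where
  \<open>C\<close> bounds the operator. As \<open>k\<close> tends to infinity this forces \<open>|\<phi>| \<le> C\<close> on the ball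
  (\<open>besov_bounded_imp_bounded_symbol\<close>).

  If \<open>\<phi>\<close> is bounded, then the weighted norm of \<open>h\<close> is at most a multiple of the norm of \<open>f\<close>, and the
  task is to estimate the full gradient of \<open>g\<close> by \<open>R g = h\<close> alone. Differentiating under the
  integral gives \<open>\<partial>\<^sub>j g (z)\<close> as the integral of \<open>\<partial>\<^sub>j h (t z)\<close> over \<open>0 \<le> t \<le> 1\<close>. Cauchy's estimate bounds
  \<open>\<partial>\<^sub>j h\<close> by \<open>h\<close> at the cost of one power of the distance to the boundary
  (\<open>bergman_pow_partial_deriv_le\<close>), and Hardy's inequality for the integral along the radius wins
  this power back (\<open>radial_hardy\<close>), because \<open>\<alpha> > - 1\<close>. Hardy's inequality follows from
  Jensen's inequality on each radius and from the behaviour of weighted integrals under dilations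
  (\<open>dilation_average_le\<close>).
\<close>

section \<open>Holomorphic functions of several variables\<close>

lemma complex_linear_eq_sum:
  fixes D :: "complex ^ 'n \<Rightarrow> complex"
  assumes "linear D" and "\<And>c v. D (c *s v) = c * D v"
  shows "D v = (\<Sum>j\<in>UNIV. v $ j * D (axis j 1))"
proof -
  have "v = (\<Sum>j\<in>UNIV. v $ j *s axis j 1)"
    by (simp add: vec_eq_iff axis_def if_distrib sum.delta cong: if_cong)
  then have "D v = (\<Sum>j\<in>UNIV. D (v $ j *s axis j 1))"
    using linear_sum[OF assms(1)] by metis
  then show ?thesis by (simp add: assms(2))
qed

lemma bounded_linear_scale_vec: "bounded_linear (\<lambda>c::complex. c *s (v :: complex ^ 'n))"
  unfolding linear_conv_bounded_linear[symmetric]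
  by (rule linearI) (simp_all add: vec_eq_iff algebra_simps)

lemma sum_axis: "(\<Sum>i\<in>UNIV. axis j 1 $ i * c i) = (c j :: complex)"
  by (simp add: axis_def sum.delta if_distrib[of "\<lambda>x. x * _"] cong: if_cong)

lemma partial_deriv_eqI:
  fixes f :: "complex ^ 'n \<Rightarrow> complex"
  assumes D: "(f has_derivative D) (at z)" and hom: "\<And>c v. D (c *s v) = c * D v"
  shows "partial_deriv f j z = D (axis j 1)"
proof -
  have eq: "(\<chi> i. if i = j then w else z $ i) = z + (w - z $ j) *s axis j 1" for w
    by (simp add: vec_eq_iff axis_def)
  have 1: "((\<lambda>w. (\<chi> i. if i = j then w else z $ i)) has_derivative (\<lambda>h. h *s axis j 1)) (at (z $ j))"
    unfolding eq
    by (rule derivative_eq_intros bounded_linear.has_derivative[OF bounded_linear_scale_vec] refl)+ auto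
  have 2: "(\<chi> i. if i = j then z $ j else z $ i) = z" by (simp add: vec_eq_iff)
  have "((f \<circ> (\<lambda>w. (\<chi> i. if i = j then w else z $ i))) has_derivative (D \<circ> (\<lambda>h. h *s axis j 1))) (at (z $ j))"
    by (rule diff_chain_at[OF 1]) (simp add: 2 D)
  then have "((\<lambda>w. f (\<chi> i. if i = j then w else z $ i)) has_field_derivative D (axis j 1)) (at (z $ j))"
    unfolding has_field_derivative_def o_def
    by (rule has_derivative_eq_rhs) (simp add: fun_eq_iff hom mult.commute)
  then show ?thesis
    unfolding partial_deriv_def by (rule DERIV_imp_deriv)
qed

text \<open>
  Any complex linear map is determined by its values on the unit vectors, so the derivative in
  the definition of holomorphy has to be the one built from the partial derivatives. This is the
  form in which holomorphy is used below.
\<close>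

lemma mv_holomorphic_on_iff:
  fixes f :: "complex ^ 'n \<Rightarrow> complex"
  assumes "open S"
  shows "mv_holomorphic_on f S \<longleftrightarrow>
    (\<forall>z\<in>S. (f has_derivative (\<lambda>v. \<Sum>j\<in>UNIV. v $ j * partial_deriv f j z)) (at z))"
proof
  assume L: "mv_holomorphic_on f S"
  show "\<forall>z\<in>S. (f has_derivative (\<lambda>v. \<Sum>j\<in>UNIV. v $ j * partial_deriv f j z)) (at z)"
  proof
    fix z assume z: "z \<in> S"
    then obtain D where D: "(f has_derivative D) (at z)" "\<And>c v. D (c *s v) = c * D v"
      using L at_within_open[OF z assms] unfolding mv_holomorphic_on_def by metis
    have "D = (\<lambda>v. \<Sum>j\<in>UNIV. v $ j * partial_deriv f j z)"
      unfolding partial_deriv_eqI[OF D]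
      by (rule ext) (rule complex_linear_eq_sum[OF has_derivative_linear[OF D(1)] D(2)])
    with D(1) show "(f has_derivative (\<lambda>v. \<Sum>j\<in>UNIV. v $ j * partial_deriv f j z)) (at z)" by simp
  qed
next
  assume R: "\<forall>z\<in>S. (f has_derivative (\<lambda>v. \<Sum>j\<in>UNIV. v $ j * partial_deriv f j z)) (at z)"
  show "mv_holomorphic_on f S"
    unfolding mv_holomorphic_on_def
    by (intro ballI exI[where x="\<lambda>v. \<Sum>j\<in>UNIV. v $ j * partial_deriv f j z" for z])
       (use R in \<open>auto intro: has_derivative_at_withinI simp: sum_distrib_left mult_ac\<close>)
qed

lemmas mv_holomorphic_has_derivative = mv_holomorphic_on_iff[THEN iffD1, rule_format]

lemma mv_holomorphic_onI:
  assumes "\<And>z. z \<in> S \<Longrightarrow> (f has_derivative D z) (at z)"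
    and "\<And>z c v. z \<in> S \<Longrightarrow> D z (c *s v) = c * D z v"
  shows "mv_holomorphic_on f S"
  unfolding mv_holomorphic_on_def using assms has_derivative_at_withinI by metis

lemma mv_holomorphic_on_subset:
  "mv_holomorphic_on f S \<Longrightarrow> T \<subseteq> S \<Longrightarrow> mv_holomorphic_on f T"
  unfolding mv_holomorphic_on_def using has_derivative_subset by blast

lemma mv_holomorphic_imp_continuous_on:
  "mv_holomorphic_on f S \<Longrightarrow> continuous_on S f"
  unfolding mv_holomorphic_on_def continuous_on_eq_continuous_within
  using has_derivative_continuous by blast

lemma mv_holomorphic_mult:
  assumes "mv_holomorphic_on f S" "mv_holomorphic_on g S"
  shows "mv_holomorphic_on (\<lambda>z. f z * g z) S"
  unfolding mv_holomorphic_on_def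
proof
  fix z assume "z \<in> S"
  then obtain D E where "(f has_derivative D) (at z within S)" "\<forall>c v. D (c *s v) = c * D v"
     "(g has_derivative E) (at z within S)" "\<forall>c v. E (c *s v) = c * E v"
    using assms unfolding mv_holomorphic_on_def by blast
  then show "\<exists>D. ((\<lambda>z. f z * g z) has_derivative D) (at z within S) \<and> (\<forall>c v. D (c *s v) = c * D v)"
    by (intro exI[where x="\<lambda>h. f z * E h + D h * g z"] conjI has_derivative_mult) (simp_all add: algebra_simps)
qed

lemma mv_holomorphic_sum:
  assumes "\<And>i. i \<in> I \<Longrightarrow> mv_holomorphic_on (f i) S"
  shows "mv_holomorphic_on (\<lambda>z. \<Sum>i\<in>I. f i z) S"
  unfolding mv_holomorphic_on_def
proof
  fix z assume "z \<in> S"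
  then have "\<forall>i\<in>I. \<exists>D. (f i has_derivative D) (at z within S) \<and> (\<forall>c v. D (c *s v) = c * D v)"
    using assms unfolding mv_holomorphic_on_def by blast
  from bchoice[OF this] obtain D where
    "\<And>i. i \<in> I \<Longrightarrow> (f i has_derivative D i) (at z within S) \<and> (\<forall>c v. D i (c *s v) = c * D i v)"
    by blast
  then show "\<exists>D. ((\<lambda>z. \<Sum>i\<in>I. f i z) has_derivative D) (at z within S) \<and> (\<forall>c v. D (c *s v) = c * D v)"
    by (intro exI[where x="\<lambda>h. \<Sum>i\<in>I. D i h"]) (auto intro!: has_derivative_sum simp: sum_distrib_left)
qed

lemma mv_holomorphic_const: "mv_holomorphic_on (\<lambda>z. c) S"
  by (rule mv_holomorphic_onI[where D="\<lambda>z v. 0"]) auto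

lemma mv_holomorphic_component: "mv_holomorphic_on (\<lambda>z. z $ j) S"
  by (rule mv_holomorphic_onI[where D="\<lambda>z v. v $ j"])
     (auto intro: bounded_linear.has_derivative[OF bounded_linear_vec_nth has_derivative_ident])

lemma mv_holomorphic_compose_affine:
  assumes f: "mv_holomorphic_on f S" and S: "\<And>z. z \<in> T \<Longrightarrow> a + t *\<^sub>R z \<in> S" and "open S"
  shows "mv_holomorphic_on (\<lambda>z. f (a + t *\<^sub>R z)) T"
    and "\<And>z j. z \<in> T \<Longrightarrow> partial_deriv (\<lambda>z. f (a + t *\<^sub>R z)) j z = of_real t * partial_deriv f j (a + t *\<^sub>R z)"
proof -
  let ?D = "\<lambda>z v. \<Sum>j\<in>UNIV. (t *\<^sub>R v) $ j * partial_deriv f j (a + t *\<^sub>R z)"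
  have D: "((\<lambda>z. f (a + t *\<^sub>R z)) has_derivative ?D z) (at z)" if "z \<in> T" for z
  proof -
    have "((\<lambda>z. a + t *\<^sub>R z) has_derivative (\<lambda>v. t *\<^sub>R v)) (at z)"
      by (auto intro!: derivative_eq_intros)
    from diff_chain_at[OF this mv_holomorphic_has_derivative[OF \<open>open S\<close> f S[OF that]]]
    show ?thesis by (simp add: o_def)
  qed
  have hom: "?D z (c *s v) = c * ?D z v" for z c v
    by (simp add: sum_distrib_left scaleR_conv_of_real[where 'a=complex] mult_ac)
  show "mv_holomorphic_on (\<lambda>z. f (a + t *\<^sub>R z)) T"
    by (rule mv_holomorphic_onI[OF D hom])
  show "partial_deriv (\<lambda>z. f (a + t *\<^sub>R z)) j z = of_real t * partial_deriv f j (a + t *\<^sub>R z)" if "z \<in> T" for z j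
    unfolding partial_deriv_eqI[OF D[OF that] hom]
    by (simp add: axis_def scaleR_conv_of_real[where 'a=complex] if_distrib sum.delta if_distribR cong: if_cong)
qed

lemma slice_has_field_derivative:
  fixes f :: "complex ^ 'n \<Rightarrow> complex"
  assumes "open S" "mv_holomorphic_on f S" "z + c *s v \<in> S"
  shows "((\<lambda>c. f (z + c *s v)) has_field_derivative
      (\<Sum>j\<in>UNIV. v $ j * partial_deriv f j (z + c *s v))) (at c)"
proof -
  have "((\<lambda>c. z + c *s v) has_derivative (\<lambda>h. h *s v)) (at c)"
    by (rule derivative_eq_intros bounded_linear.has_derivative[OF bounded_linear_scale_vec] refl)+ auto
  from diff_chain_at[OF this mv_holomorphic_has_derivative[OF assms]]
  show ?thesis
    unfolding has_field_derivative_def o_def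
    by (rule has_derivative_eq_rhs) (simp add: fun_eq_iff sum_distrib_left sum_distrib_right mult_ac)
qed

lemma slice_holomorphic:
  fixes f :: "complex ^ 'n \<Rightarrow> complex"
  assumes "open S" "mv_holomorphic_on f S" "\<And>c. c \<in> T \<Longrightarrow> z + c *s v \<in> S" "open T"
  shows "(\<lambda>c. f (z + c *s v)) holomorphic_on T"
  using slice_has_field_derivative[OF assms(1,2)] assms(3,4)
  by (subst holomorphic_on_open) blast+

lemma norm_scale_vec: "norm (c *s (v :: complex ^ 'n)) = norm c * norm v"
  by (simp add: norm_vec_def norm_mult L2_set_right_distrib)

text \<open>
  Cauchy's formulas for the value and the derivative at the centre, with the contour integral
  written out over the parameter interval. In this form they can be fed to theorems on real
  parameter integrals and to Jensen's inequality.
\<close>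

lemma circle_integrals:
  fixes r R :: real
  assumes u: "u holomorphic_on ball 0 R" and r: "0 < r" "r < R"
  shows "((\<lambda>t. u (r * cis (2 * pi * t))) has_integral u 0) {0..1}"
    and "((\<lambda>t. u (r * cis (2 * pi * t)) / (r * cis (2 * pi * t))) has_integral deriv u 0) {0..1}"
proof -
  have sub: "cball 0 r \<subseteq> ball (0::complex) R" using r by auto
  have cont: "continuous_on (cball 0 r) u" and hol: "u holomorphic_on ball 0 r"
    using u holomorphic_on_imp_continuous_on holomorphic_on_subset sub ball_subset_cball subset_trans by metis+
  have vd: "vector_derivative (circlepath 0 r) (at t within {0..1}) = 2 * pi * \<i> * (r * cis (2 * pi * t))"
    if "t \<in> {0..1}" for t
    using vector_derivative_circlepath01[of t 0 r] that by (simp add: cis_conv_exp mult_ac)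
  have cp: "circlepath 0 r t = r * cis (2 * pi * t)" for t
    by (simp add: circlepath cis_conv_exp mult_ac)
  have *: "((\<lambda>t. g (r * cis (2 * pi * t)) * (r * cis (2 * pi * t))) has_integral i) {0..1}"
    if "(g has_contour_integral (2 * of_real pi * \<i> * i)) (circlepath 0 r)" for g i
  proof -
    have "((\<lambda>t. g (r * cis (2 * pi * t)) * (2 * pi * \<i> * (r * cis (2 * pi * t)))) has_integral (2 * of_real pi * \<i> * i)) {0..1}"
      using that unfolding has_contour_integral_def
      by (rule has_integral_eq[rotated]) (simp add: vd cp)
    then have "((\<lambda>t. (1 / (2 * pi * \<i>)) * (g (r * cis (2 * pi * t)) * (2 * pi * \<i> * (r * cis (2 * pi * t)))))
       has_integral (1 / (2 * pi * \<i>)) * (2 * of_real pi * \<i> * i)) {0..1}"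
      by (rule has_integral_mult_right)
    moreover have "(1 / (2 * pi * \<i>)) * (G * (2 * pi * \<i> * Z)) = G * Z" for G Z
    proof -
      have "(1 / (2 * pi * \<i>)) * (G * (2 * pi * \<i> * Z)) = ((1 / (2 * pi * \<i>)) * (2 * pi * \<i>)) * (G * Z)"
        by (simp only: mult_ac)
      then show ?thesis by simp
    qed
    ultimately show ?thesis by (simp only:) simp
  qed
  show "((\<lambda>t. u (r * cis (2 * pi * t))) has_integral u 0) {0..1}"
    using *[OF Cauchy_integral_circlepath[OF cont hol, of 0, simplified, OF r(1)]] r by simp
  have d: "deriv u 0 = 1 / (2 * of_real pi * \<i>) * contour_integral(circlepath 0 r) (\<lambda>x. u x / x^2)"
    using Cauchy_derivative_integral_circlepath(2)[OF cont hol, of 0] r by (simp add: DERIV_imp_deriv)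
  have "((\<lambda>x. u x / x^2) has_contour_integral (2 * of_real pi * \<i> * deriv u 0)) (circlepath 0 r)"
    using has_contour_integral_integral[OF Cauchy_derivative_integral_circlepath(1)[OF cont hol, of 0]] r
    unfolding d by simp
  from *[OF this] show "((\<lambda>t. u (r * cis (2 * pi * t)) / (r * cis (2 * pi * t))) has_integral deriv u 0) {0..1}"
    using r by (simp add: power2_eq_square)
qed

lemma partial_deriv_circle_integral:
  fixes f :: "complex ^ 'n \<Rightarrow> complex" and r R :: real
  assumes "open S" "mv_holomorphic_on f S" "ball z R \<subseteq> S" "0 < r" "r < R"
  shows "((\<lambda>t. f (z + (r * cis (2 * pi * t)) *s axis j 1) / (r * cis (2 * pi * t))) has_integral partial_deriv f j z) {0..1}"
proof -
  have in_S: "z + c *s axis j 1 \<in> S" if "c \<in> ball 0 R" for c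
    using that assms(3) by (auto simp: subset_iff dist_norm norm_scale_vec norm_axis_1)
  have "(\<lambda>c. f (z + c *s axis j 1)) holomorphic_on ball 0 R"
    by (rule slice_holomorphic[OF assms(1,2) in_S]) auto
  note circle_integrals(2)[OF this assms(4,5)]
  moreover have "deriv (\<lambda>c. f (z + c *s axis j 1)) 0 = partial_deriv f j z"
    using DERIV_imp_deriv[OF slice_has_field_derivative[OF assms(1,2) in_S, of 0]] assms(4,5)
    by (simp add: sum_axis)
  ultimately show ?thesis by simp
qed

lemma mv_holomorphic_cong:
  assumes "\<And>z. z \<in> S \<Longrightarrow> f z = g z"
  shows "mv_holomorphic_on f S \<longleftrightarrow> mv_holomorphic_on g S"
proof -
  have "(f has_derivative D) (at z within S) \<longleftrightarrow> (g has_derivative D) (at z within S)" if "z \<in> S" for z D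
    using has_derivative_transform[of z S f g D] has_derivative_transform[of z S g f D] assms that by auto
  then show ?thesis unfolding mv_holomorphic_on_def by blast
qed

lemma mv_holomorphic_locally:
  assumes "\<And>z. z \<in> S \<Longrightarrow> \<exists>r>0. mv_holomorphic_on f (ball z r)"
  shows "mv_holomorphic_on f S"
proof (rule mv_holomorphic_onI)
  fix z assume "z \<in> S"
  then obtain r where r: "r > 0" "mv_holomorphic_on f (ball z r)" using assms by blast
  from mv_holomorphic_has_derivative[OF _ r(2), of z] r(1)
  show "(f has_derivative (\<lambda>v. \<Sum>j\<in>UNIV. v $ j * partial_deriv f j z)) (at z)" by simp
qed (simp add: sum_distrib_left mult_ac)

lemma partial_deriv_cong:
  assumes "open S" "z \<in> S" "\<And>z. z \<in> S \<Longrightarrow> f z = g z" "mv_holomorphic_on f S"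
  shows "partial_deriv f j z = partial_deriv g j z"
proof -
  have "(g has_derivative (\<lambda>v. \<Sum>j\<in>UNIV. v $ j * partial_deriv f j z)) (at z)"
    by (rule has_derivative_transform_within_open[OF mv_holomorphic_has_derivative[OF assms(1,4,2)] assms(1,2,3)])
  moreover have "(\<Sum>j\<in>UNIV. (c *s v) $ j * partial_deriv f j z) = c * (\<Sum>j\<in>UNIV. v $ j * partial_deriv f j z)" for c v
    by (simp add: sum_distrib_left mult_ac)
  ultimately show ?thesis using partial_deriv_eqI[of g _ z j] by (simp add: sum_axis)
qed

section \<open>Cauchy's formula and parameter integrals\<close>

lemma ball_around_shifted_centre:
  fixes z0 :: "'a::euclidean_space"
  assumes "z \<in> ball z0 r" "ball z0 (3 * r) \<subseteq> S"
  shows "ball z (2 * r) \<subseteq> S"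
proof -
  have "ball z (2 * r) \<subseteq> ball z0 (3 * r)"
    using assms(1) by (intro ball_subset_ball_iff[THEN iffD2]) (simp add: dist_commute)
  then show ?thesis using assms(2) by blast
qed

lemma circle_around_shifted_centre:
  fixes z0 :: "complex ^ 'n" and r :: real
  assumes "z \<in> ball z0 r" "0 < r" "ball z0 (3 * r) \<subseteq> S"
  shows "z + (r * cis s) *s axis j 1 \<in> S"
proof -
  have "z + (r * cis s) *s axis j 1 \<in> ball z (2 * r)"
    using assms(2) by (simp add: dist_norm norm_scale_vec norm_mult norm_axis_1)
  then show ?thesis using ball_around_shifted_centre[OF assms(1,3)] by blast
qed

text \<open>
  Frechet differentiability gives no continuity of the derivative by itself. It comes from
  Cauchy's formula: near each point the partial derivative is an integral, over a circle of fixed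
  radius, of a jointly continuous function.
\<close>

lemma continuous_on_partial_deriv_param:
  fixes F :: "complex ^ 'n \<Rightarrow> real \<Rightarrow> complex"
  assumes U: "open U" and cont: "continuous_on (U \<times> T) (\<lambda>(z, t). F z t)"
    and hol: "\<And>t. t \<in> T \<Longrightarrow> mv_holomorphic_on (\<lambda>z. F z t) U"
  shows "continuous_on (U \<times> T) (\<lambda>(z, t). partial_deriv (\<lambda>z. F z t) j z)"
  unfolding continuous_on_eq_continuous_within
proof
  fix x assume "x \<in> U \<times> T"
  then obtain z0 t0 where x: "x = (z0, t0)" and "z0 \<in> U" "t0 \<in> T" by auto
  then obtain R where R: "R > 0" "ball z0 R \<subseteq> U" using U openE by blast
  define r where "r = R / 3"
  have r: "r > 0" using R by (simp add: r_def)
  define V where "V = ball z0 r \<times> T"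
  have R': "ball z0 (3 * r) \<subseteq> U" using R by (simp add: r_def)
  note ball = ball_around_shifted_centre[OF _ R'] and in_U = circle_around_shifted_centre[OF _ r R']
  have "continuous_on V (\<lambda>x. integral (cbox 0 1) (\<lambda>s.
      F (fst x + (r * cis (2 * pi * s)) *s axis j 1) (snd x) / (r * cis (2 * pi * s))))"
  proof (rule integral_continuous_on_param)
    have *: "continuous_on (V \<times> cbox 0 1)
       (\<lambda>y. case (fst (fst y) + (r * cis (2 * pi * snd y)) *s axis j 1, snd (fst y)) of (z, t) \<Rightarrow> F z t)"
      by (rule continuous_on_compose2[OF cont])
         (auto intro!: continuous_intros bounded_linear.continuous_on[OF bounded_linear_scale_vec]
            simp: V_def in_U)
    show "continuous_on (V \<times> cbox 0 1) (\<lambda>(x, s).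
        F (fst x + (r * cis (2 * pi * s)) *s axis j 1) (snd x) / (r * cis (2 * pi * s)))"
      using * r unfolding split_beta
      by (auto intro!: continuous_intros)
  qed
  moreover have "(case y of (z, t) \<Rightarrow> partial_deriv (\<lambda>z. F z t) j z) = integral (cbox 0 1) (\<lambda>s.
      F (fst y + (r * cis (2 * pi * s)) *s axis j 1) (snd y) / (r * cis (2 * pi * s)))" if "y \<in> V" for y
    using partial_deriv_circle_integral[OF U hol ball r, of "snd y" "fst y" j] that r
    by (auto simp: V_def integral_unique)
  ultimately have "continuous_on V (\<lambda>(z, t). partial_deriv (\<lambda>z. F z t) j z)"
    by (simp cong: continuous_on_cong)
  moreover have "x \<in> V" using r \<open>t0 \<in> T\<close> by (simp add: V_def x)
  ultimately have "continuous (at x within V) (\<lambda>(z, t). partial_deriv (\<lambda>z. F z t) j z)"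
    by (simp add: continuous_on_eq_continuous_within)
  moreover have "at x within V = at x within (U \<times> T)"
  proof (rule at_within_nhd)
    show "x \<in> ball z0 r \<times> UNIV" "open (ball z0 r \<times> (UNIV :: real set))"
      using r by (auto simp: x intro: open_Times)
    have "ball z0 r \<subseteq> U" using R r by (auto simp: r_def)
    then show "V \<inter> ball z0 r \<times> UNIV - {x} = U \<times> T \<inter> ball z0 r \<times> UNIV - {x}"
      by (auto simp: V_def)
  qed
  ultimately show "continuous (at x within U \<times> T) (\<lambda>(z, t). partial_deriv (\<lambda>z. F z t) j z)" by simp
qed

lemma continuous_on_partial_deriv:
  assumes "open S" "mv_holomorphic_on f S"
  shows "continuous_on S (partial_deriv f j)"
proof -
  have c: "continuous_on (S \<times> {0::real}) (\<lambda>(z, t). f z)"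
    using mv_holomorphic_imp_continuous_on[OF assms(2)] unfolding split_beta
    by (rule continuous_on_compose2) (auto intro!: continuous_intros)
  have "continuous_on (S \<times> {0::real}) (\<lambda>(z, t). partial_deriv f j z)"
    by (rule continuous_on_partial_deriv_param[OF assms(1) c]) (rule assms(2))
  then have "continuous_on S (\<lambda>z. case (z, 0::real) of (z, t) \<Rightarrow> partial_deriv f j z)"
    by (rule continuous_on_compose2) (auto intro!: continuous_intros)
  then show ?thesis by simp
qed

text \<open>
  Differentiation under the integral sign. Joint continuity of the integrand is enough, because
  for holomorphic integrands the continuity of the derivative that Leibniz' rule asks for follows
  from Cauchy's formula.
\<close>

lemma integral_param_has_derivative:
  fixes F :: "complex ^ 'n \<Rightarrow> real \<Rightarrow> complex"
  assumes U: "open U" "convex U" and cont: "continuous_on (U \<times> {0..1}) (\<lambda>(z, t). F z t)"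
    and hol: "\<And>t. t \<in> {0..1} \<Longrightarrow> mv_holomorphic_on (\<lambda>z. F z t) U" and z: "z \<in> U"
  shows "((\<lambda>z. integral {0..1} (F z)) has_derivative
    (\<lambda>v. \<Sum>j\<in>UNIV. v $ j * integral {0..1} (\<lambda>t. partial_deriv (\<lambda>z. F z t) j z))) (at z)"
proof -
  let ?d = "\<lambda>j t z. partial_deriv (\<lambda>z. F z t) j z"
  define L where "L = (\<lambda>z t. Blinfun (\<lambda>v. \<Sum>j\<in>UNIV. v $ j * ?d j t z))"
  have "bounded_linear (\<lambda>v :: complex ^ 'n. \<Sum>j\<in>UNIV. v $ j * c j)" for c :: "'n \<Rightarrow> complex"
    by (intro bounded_linear_sum bounded_linear_compose[OF bounded_linear_mult_left bounded_linear_vec_nth])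
  then have L: "blinfun_apply (L z t) v = (\<Sum>j\<in>UNIV. v $ j * ?d j t z)" for z t v
    by (simp add: L_def bounded_linear_Blinfun_apply)
  have d_cont: "continuous_on (U \<times> {0..1}) (\<lambda>x. ?d j (snd x) (fst x))" for j
    using continuous_on_partial_deriv_param[OF U(1) cont hol, of j] by (simp add: split_beta)
  have L_cont: "continuous_on (U \<times> cbox 0 1) (\<lambda>(z, t). L z t)"
    unfolding split_beta using d_cont
    by (intro continuous_on_blinfun_componentwise) (auto simp: L intro!: continuous_intros)
  have "((\<lambda>z. integral (cbox 0 1) (F z)) has_derivative integral (cbox 0 1) (L z)) (at z within U)"
  proof (rule leibniz_rule)
    show "((\<lambda>z. F z t) has_derivative blinfun_apply (L z t)) (at z within U)"
      if "z \<in> U" "t \<in> cbox 0 1" for z t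
      unfolding L using mv_holomorphic_has_derivative[OF U(1) hol[of t] \<open>z \<in> U\<close>] that
      by (simp add: has_derivative_at_withinI)
    show "F z integrable_on cbox 0 1" if "z \<in> U" for z
      by (rule integrable_continuous) (use that in \<open>auto intro!: continuous_on_compose2[OF cont, of _ "Pair z", simplified] continuous_intros\<close>)
  qed (use L_cont z U in auto)
  moreover have "blinfun_apply (integral (cbox 0 1) (L z)) = (\<lambda>v. \<Sum>j\<in>UNIV. v $ j * integral {0..1} (\<lambda>t. ?d j t z))"
  proof
    fix v
    have "continuous_on (cbox 0 1) (L z)"
      using z by (auto intro!: continuous_on_compose2[OF L_cont, of _ "Pair z", simplified] continuous_intros)
    then have int: "L z integrable_on cbox 0 1" by (rule integrable_continuous)
    have d_int: "(\<lambda>t. ?d j t z) integrable_on cbox 0 1" for j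
      using z by (intro integrable_continuous) (auto intro!: continuous_on_compose2[OF d_cont, of _ "Pair z", simplified] continuous_intros)
    have "integral (cbox 0 1) (L z) v = integral (cbox 0 1) (\<lambda>t. L z t v)"
      using integral_linear[OF int blinfun.bounded_linear_left[of v]] by (simp add: o_def)
    also have "\<dots> = (\<Sum>j\<in>UNIV. integral (cbox 0 1) (\<lambda>t. v $ j * ?d j t z))"
      unfolding L by (rule integral_sum) (use d_int in \<open>auto intro: integrable_on_mult_right\<close>)
    finally show "integral (cbox 0 1) (L z) v = (\<Sum>j\<in>UNIV. v $ j * integral {0..1} (\<lambda>t. ?d j t z))" by simp
  qed
  ultimately show ?thesis
    unfolding at_within_open[OF z U(1)] cbox_interval by (simp only:)
qed

lemma
  fixes F :: "complex ^ 'n \<Rightarrow> real \<Rightarrow> complex"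
  assumes "open U" "convex U" and "continuous_on (U \<times> {0..1}) (\<lambda>(z, t). F z t)"
    and "\<And>t. t \<in> {0..1} \<Longrightarrow> mv_holomorphic_on (\<lambda>z. F z t) U"
  shows mv_holomorphic_integral_param: "mv_holomorphic_on (\<lambda>z. integral {0..1} (F z)) U"
    and partial_deriv_integral_param: "z \<in> U \<Longrightarrow>
      partial_deriv (\<lambda>z. integral {0..1} (F z)) j z = integral {0..1} (\<lambda>t. partial_deriv (\<lambda>z. F z t) j z)"
proof -
  have D: "((\<lambda>z. integral {0..1} (F z)) has_derivative
    (\<lambda>v. \<Sum>j\<in>UNIV. v $ j * integral {0..1} (\<lambda>t. partial_deriv (\<lambda>z. F z t) j z))) (at z)" if "z \<in> U" for z
    using integral_param_has_derivative[OF assms that] .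
  have hom: "(\<Sum>j\<in>UNIV. (c *s v) $ j * a j) = c * (\<Sum>j\<in>UNIV. v $ j * a j)" for c v and a :: "'n \<Rightarrow> complex"
    by (simp add: sum_distrib_left mult_ac)
  show "mv_holomorphic_on (\<lambda>z. integral {0..1} (F z)) U"
    by (rule mv_holomorphic_onI[OF D hom])
  show "partial_deriv (\<lambda>z. integral {0..1} (F z)) j z = integral {0..1} (\<lambda>t. partial_deriv (\<lambda>z. F z t) j z)" if "z \<in> U"
    using partial_deriv_eqI[OF D[OF that] hom, of j] by (simp add: sum_axis)
qed

text \<open>
  By Cauchy's formula a partial derivative is locally a parameter integral of translates of the
  function, and these translates are holomorphic.
\<close>

lemma mv_holomorphic_partial_deriv:
  assumes S: "open S" "mv_holomorphic_on f S"
  shows "mv_holomorphic_on (partial_deriv f j) S"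
proof (rule mv_holomorphic_locally)
  fix z0 assume "z0 \<in> S"
  then obtain R where R: "R > 0" "ball z0 R \<subseteq> S" using S openE by blast
  define r where "r = R / 3"
  have r: "r > 0" using R by (simp add: r_def)
  have R': "ball z0 (3 * r) \<subseteq> S" using R by (simp add: r_def)
  note ball = ball_around_shifted_centre[OF _ R'] and in_S = circle_around_shifted_centre[OF _ r R']
  let ?F = "\<lambda>z t. f (z + (r * cis (2 * pi * t)) *s axis j 1) * (1 / (r * cis (2 * pi * t)))"
  have "mv_holomorphic_on (\<lambda>z. integral {0..1} (?F z)) (ball z0 r)"
  proof (rule mv_holomorphic_integral_param)
    have "continuous_on (ball z0 r \<times> {0..1::real}) (\<lambda>y. f (fst y + (r * cis (2 * pi * snd y)) *s axis j 1))"
      by (rule continuous_on_compose2[OF mv_holomorphic_imp_continuous_on[OF S(2)]])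
         (auto intro!: continuous_intros bounded_linear.continuous_on[OF bounded_linear_scale_vec] simp: in_S)
    then show "continuous_on (ball z0 r \<times> {0..1}) (\<lambda>(z, t). ?F z t)"
      using r unfolding split_beta by (auto intro!: continuous_intros)
    show "mv_holomorphic_on (\<lambda>z. ?F z t) (ball z0 r)" for t
      using mv_holomorphic_compose_affine(1)[OF S(2) _ S(1), of "ball z0 r" "(r * cis (2 * pi * t)) *s axis j 1" 1] in_S
      by (intro mv_holomorphic_mult mv_holomorphic_const) (simp add: add.commute)
  qed auto
  moreover have "integral {0..1} (?F z) = partial_deriv f j z" if "z \<in> ball z0 r" for z
    using partial_deriv_circle_integral[OF S ball[OF that] r, of j] r by (simp add: integral_unique)
  ultimately have "mv_holomorphic_on (partial_deriv f j) (ball z0 r)"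
    by (subst (asm) mv_holomorphic_cong)
  then show "\<exists>r>0. mv_holomorphic_on (partial_deriv f j) (ball z0 r)" using r by blast
qed

section \<open>Jensen's inequality and rotation invariance\<close>

text \<open>
  The graph of the convex function \<open>x powr p\<close> lies above its tangent at \<open>c\<close>.
\<close>

lemma powr_tangent_le:
  fixes x c p :: real
  assumes "0 \<le> x" "0 \<le> c" "1 < p"
  shows "p * c powr (p - 1) * x \<le> x powr p + (p - 1) * c powr p"
proof -
  have "1 < p / (p - 1)" "1 / p + 1 / (p / (p - 1)) = 1"
    using assms by (auto simp: field_simps)
  from Youngs_inequality[OF \<open>1 < p\<close> this assms(1), of "c powr (p - 1)"]
  have "x * c powr (p - 1) \<le> x powr p / p + c powr p * (p - 1) / p"
    using assms by (simp add: powr_powr)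
  also have "\<dots> = (x powr p + (p - 1) * c powr p) / p"
    by (simp add: add_divide_distrib mult.commute)
  finally show ?thesis using assms by (simp add: field_simps)
qed

text \<open>
  Jensen's inequality for \<open>x powr p\<close> and the quotient \<open>v / k\<close> with respect to the measure with
  density \<open>k\<close>; equivalently, Hoelder's inequality for the product of \<open>v / k powr (1 - 1 / p)\<close> and
  \<open>k powr (1 - 1 / p)\<close>. The proof integrates the tangent inequality at the mean value. The
  bound \<open>K\<close> stands for the mass of \<open>k\<close>, which in applications is easier to estimate than to compute.
\<close>

lemma weighted_jensen:
  fixes v k :: "real \<Rightarrow> real"
  assumes v: "continuous_on {a..b} v" "\<And>t. t \<in> {a..b} \<Longrightarrow> 0 \<le> v t"
    and k: "continuous_on {a..b} k" "\<And>t. t \<in> {a..b} \<Longrightarrow> 0 < k t"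
    and p: "1 < p" and K: "integral {a..b} k \<le> K" "0 < K"
  shows "integral {a..b} v powr p \<le> K powr (p - 1) * integral {a..b} (\<lambda>t. v t powr p * k t powr (1 - p))"
proof -
  \<comment> \<open>the point of tangency: the mean of \<open>v / k\<close>, up to replacing the mass of \<open>k\<close> by \<open>K\<close>\<close>
  define c where "c = integral {a..b} v / K"
  define J where "J = integral {a..b} (\<lambda>t. v t powr p * k t powr (1 - p))"
  have I: "0 \<le> integral {a..b} v"
    using v by (intro integral_nonneg integrable_continuous_real) auto
  then have c: "0 \<le> c" using K by (simp add: c_def)
  have Ic: "integral {a..b} v = c * K" using K by (simp add: c_def)
  have ptw: "p * c powr (p - 1) * v t \<le> v t powr p * k t powr (1 - p) + (p - 1) * c powr p * k t"
    if t: "t \<in> {a..b}" for t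
  proof -
    have "p * c powr (p - 1) * (v t / k t) * k t \<le> ((v t / k t) powr p + (p - 1) * c powr p) * k t"
      by (intro mult_right_mono powr_tangent_le) (use v k t c p in \<open>auto simp: less_imp_le\<close>)
    moreover have "(v t / k t) powr p * k t = v t powr p * k t powr (1 - p)"
      using v(2)[OF t] k(2)[OF t] by (simp add: powr_divide powr_diff)
    ultimately show ?thesis using k(2)[OF t] by (simp add: algebra_simps)
  qed
  have int: "(\<lambda>t. v t powr p * k t powr (1 - p)) integrable_on {a..b}" "v integrable_on {a..b}" "k integrable_on {a..b}"
    using v k p
    by (auto intro!: integrable_continuous_real continuous_intros continuous_on_powr' simp: less_imp_le)
       (metis less_irrefl)+
  have "p * c powr (p - 1) * integral {a..b} v = integral {a..b} (\<lambda>t. p * c powr (p - 1) * v t)"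
    by simp
  also have "\<dots> \<le> integral {a..b} (\<lambda>t. v t powr p * k t powr (1 - p) + (p - 1) * c powr p * k t)"
    using ptw int by (intro integral_le integrable_add) (auto intro: integrable_on_mult_right)
  also have "\<dots> = J + (p - 1) * c powr p * integral {a..b} k"
    unfolding J_def using int by (subst integral_add) (auto intro: integrable_on_mult_right)
  also have "\<dots> \<le> J + (p - 1) * c powr p * K"
    using K p by (intro add_left_mono mult_left_mono) auto
  also have "p * c powr (p - 1) * integral {a..b} v = p * (c powr p * K)"
    unfolding Ic using c p powr_mult_base[of c "p - 1"] by (cases "c = 0") (auto simp: mult_ac)
  finally have le: "c powr p * K \<le> J" by (simp add: algebra_simps)
  have "integral {a..b} v powr p = c powr p * K powr p"
    unfolding Ic using c K by (simp add: powr_mult)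
  also have "\<dots> = K powr (p - 1) * (c powr p * K)"
    using K by (simp add: powr_diff)
  also have "\<dots> \<le> K powr (p - 1) * J" by (intro mult_left_mono le) auto
  finally show ?thesis unfolding J_def .
qed

lemma nn_integral_lborel_affine:
  fixes f :: "'a::euclidean_space \<Rightarrow> ennreal"
  assumes [measurable]: "f \<in> borel_measurable borel" and c: "c \<noteq> 0"
  shows "(\<integral>\<^sup>+x. f x \<partial>lborel) = ennreal (\<bar>c\<bar> ^ DIM('a)) * (\<integral>\<^sup>+x. f (t + c *\<^sub>R x) \<partial>lborel)"
  by (subst lborel_affine[OF c, of t])
     (simp add: nn_integral_density nn_integral_distr nn_integral_cmult)

text \<open>
  A linear isometry transports Lebesgue measure to a translation invariant measure, and such a
  measure is a multiple of Lebesgue measure: for a Borel set \<open>A\<close> and the unit ball \<open>B\<close>, Tonelli's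
  theorem and translations turn \<open>\<mu>(A) \<lambda>(B)\<close> into \<open>\<lambda>(A) \<mu>(B)\<close>. Since the isometry preserves \<open>B\<close>,
  the factor is \<open>1\<close>.
\<close>

lemma nn_integral_lborel_isometry:
  fixes T :: "'a::euclidean_space \<Rightarrow> 'a"
  assumes lin: "linear T" and norm_T: "\<And>x. norm (T x) = norm x"
    and [measurable]: "f \<in> borel_measurable borel"
  shows "(\<integral>\<^sup>+x. f (T x) \<partial>lborel) = (\<integral>\<^sup>+x. f x \<partial>lborel)"
proof -
  interpret T: linear T by fact
  have T_meas [measurable]: "T \<in> borel_measurable borel"
    by (intro borel_measurable_continuous_onI linear_continuous_on linear_conv_bounded_linear[THEN iffD1] lin)
  have "inj T"
    unfolding linear_injective_0[OF lin] using norm_T by (metis norm_eq_zero)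
  then have "surj T" using linear_injective_imp_surjective[OF lin] by blast
  have "distr lborel borel T = lborel"
  proof (rule measure_eqI)
    fix A :: "'a set" assume "A \<in> sets (distr lborel borel T)"
    then have [measurable]: "A \<in> sets borel" by simp
    let ?B = "ball (0::'a) 1"
    let ?i = "\<lambda>A x. indicator A x :: ennreal"
    have [measurable]: "?B \<in> sets borel" by simp
    have B_meas: "?i ?B \<in> borel_measurable borel" by (intro borel_measurable_indicator) simp
    have B: "T x \<in> ?B \<longleftrightarrow> x \<in> ?B" for x by (simp add: norm_T)
    have "(\<integral>\<^sup>+x. ?i A (T x) \<partial>lborel) * emeasure lborel ?B
        = (\<integral>\<^sup>+x. ?i A (T x) * (\<integral>\<^sup>+y. ?i ?B y \<partial>lborel) \<partial>lborel)"
      by (simp add: nn_integral_multc)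
    also have "\<dots> = (\<integral>\<^sup>+x. (\<integral>\<^sup>+y. ?i A (T x) * ?i ?B (T x + y) \<partial>lborel) \<partial>lborel)"
    proof (rule nn_integral_cong)
      fix x
      show "?i A (T x) * (\<integral>\<^sup>+y. ?i ?B y \<partial>lborel) = (\<integral>\<^sup>+y. ?i A (T x) * ?i ?B (T x + y) \<partial>lborel)"
        using nn_integral_lborel_affine[OF B_meas, of 1 "T x"]
        by (simp add: nn_integral_cmult measurable_compose[OF _ B_meas])
    qed
    also have "\<dots> = (\<integral>\<^sup>+y. (\<integral>\<^sup>+x. ?i A (T x) * ?i ?B (T x + y) \<partial>lborel) \<partial>lborel)"
      by (rule lborel_pair.Fubini') measurable
    also have "\<dots> = (\<integral>\<^sup>+y. (\<integral>\<^sup>+x. ?i A (T x - y) * ?i ?B x \<partial>lborel) \<partial>lborel)"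
    proof (rule nn_integral_cong)
      fix y :: 'a
      obtain y' where y': "y = T y'" using \<open>surj T\<close> by (metis surjD)
      show "(\<integral>\<^sup>+x. ?i A (T x) * ?i ?B (T x + y) \<partial>lborel) = (\<integral>\<^sup>+x. ?i A (T x - y) * ?i ?B x \<partial>lborel)"
        by (subst nn_integral_lborel_affine[where c=1 and t="- y'"])
           (auto simp: y' T.diff norm_T indicator_def)
    qed
    also have "\<dots> = (\<integral>\<^sup>+x. (\<integral>\<^sup>+y. ?i A (T x - y) * ?i ?B x \<partial>lborel) \<partial>lborel)"
      by (rule lborel_pair.Fubini'[symmetric]) measurable
    also have "\<dots> = (\<integral>\<^sup>+x. (\<integral>\<^sup>+y. ?i A (T x - y) \<partial>lborel) * ?i ?B x \<partial>lborel)"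
      by (simp add: nn_integral_multc)
    also have "\<dots> = (\<integral>\<^sup>+x. (\<integral>\<^sup>+y. ?i A y \<partial>lborel) * ?i ?B x \<partial>lborel)"
      using nn_integral_lborel_affine[of "?i A" "-1"] by simp
    also have "\<dots> = emeasure lborel A * emeasure lborel ?B"
      by (simp add: nn_integral_cmult)
    finally have "(\<integral>\<^sup>+x. ?i A (T x) \<partial>lborel) * emeasure lborel ?B = emeasure lborel A * emeasure lborel ?B" .
    moreover have "unit_ball_vol (real DIM('a)) \<noteq> 0"
      by (rule less_imp_neq[symmetric]) simp
    then have "emeasure lborel ?B \<noteq> 0" "emeasure lborel ?B \<noteq> \<infinity>"
      by (simp_all add: emeasure_ball)
    ultimately have "(\<integral>\<^sup>+x. ?i A (T x) \<partial>lborel) = emeasure lborel A"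
      by (auto simp: mult.commute[of _ "emeasure lborel ?B"] ennreal_mult_cancel_left)
    moreover have "(\<integral>\<^sup>+x. ?i A (T x) \<partial>lborel) = (\<integral>\<^sup>+x. ?i A x \<partial>distr lborel borel T)"
      by (rule nn_integral_distr[symmetric]) simp_all
    moreover have "\<dots> = emeasure (distr lborel borel T) A"
      by (rule nn_integral_indicator) simp
    ultimately show "emeasure (distr lborel borel T) A = emeasure lborel A" by simp
  qed simp
  then have "(\<integral>\<^sup>+x. f x \<partial>lborel) = (\<integral>\<^sup>+x. f x \<partial>distr lborel borel T)" by simp
  then show ?thesis by (simp add: nn_integral_distr)
qed

lemma borel_measurable_indicator_mult_ennreal:
  fixes f :: "'a::topological_space \<Rightarrow> real"
  assumes "S \<in> sets borel" "continuous_on S f"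
  shows "(\<lambda>x. indicator S x * ennreal (f x)) \<in> borel_measurable borel"
proof -
  have "(\<lambda>x. ennreal (indicator S x *\<^sub>R f x)) \<in> borel_measurable borel"
    using borel_measurable_continuous_on_indicator[OF assms] by measurable
  moreover have "ennreal (indicator S x *\<^sub>R f x) = indicator S x * ennreal (f x)" for x
    by (simp add: indicator_def)
  ultimately show ?thesis by simp
qed

lemma nn_integral_eq_integral_continuous:
  fixes f :: "real \<Rightarrow> real"
  assumes "continuous_on {a..b} f" "\<And>t. t \<in> {a..b} \<Longrightarrow> 0 \<le> f t"
  shows "(\<integral>\<^sup>+t. indicator {a..b} t * ennreal (f t) \<partial>lborel) = ennreal (integral {a..b} f)"
  using nn_integral_has_integral_lebesgue'[of "{a..b}" f "integral {a..b} f"]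
    integrable_integral[OF integrable_continuous_real[OF assms(1)]] assms(2)
  by (simp add: mult.commute)

text \<open>
  The one variable mean value property on the complex line through \<open>w\<close> in direction \<open>x\<close>,
  combined with Jensen's inequality.
\<close>

lemma norm_powr_sub_mean_value_circle:
  fixes h :: "complex ^ 'n \<Rightarrow> complex"
  assumes h: "mv_holomorphic_on h (ball w r)" and x: "norm x < r" and p: "1 < p"
  shows "norm (h w) powr p \<le> integral {0..1} (\<lambda>t. norm (h (w + cis (2 * pi * t) *s x)) powr p)"
proof (cases "x = 0")
  case True then show ?thesis by simp
next
  case False
  define R where "R = r / norm x"
  have R: "1 < R" using False x by (simp add: R_def)
  have in_ball: "w + c *s x \<in> ball w r" if "c \<in> ball 0 R" for c
    using that False by (simp add: R_def dist_norm norm_scale_vec field_simps)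
  have "(\<lambda>c. h (w + c *s x)) holomorphic_on ball 0 R"
    by (rule slice_holomorphic[OF _ h in_ball]) auto
  from circle_integrals(1)[OF this, of 1] R
  have mv: "((\<lambda>t. h (w + cis (2 * pi * t) *s x)) has_integral h w) {0..1}" by simp
  have cont: "continuous_on {0..1} (\<lambda>t. h (w + cis (2 * pi * t) *s x))"
    by (rule continuous_on_compose2[OF mv_holomorphic_imp_continuous_on[OF h]])
       (use R in_ball in \<open>auto intro!: continuous_intros bounded_linear.continuous_on[OF bounded_linear_scale_vec]\<close>)
  have "norm (h w) \<le> integral {0..1} (\<lambda>t. norm (h (w + cis (2 * pi * t) *s x)))"
    unfolding integral_unique[OF mv, symmetric] using cont
    by (intro integral_norm_bound_integral integrable_continuous_real continuous_intros) auto
  then have "norm (h w) powr p \<le> integral {0..1} (\<lambda>t. norm (h (w + cis (2 * pi * t) *s x))) powr p"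
    using p by (intro powr_mono2) auto
  also have "\<dots> \<le> integral {0..1} (\<lambda>t. norm (h (w + cis (2 * pi * t) *s x)) powr p)"
    using weighted_jensen[of 0 1 "\<lambda>t. norm (h (w + cis (2 * pi * t) *s x))" "\<lambda>_. 1" p 1]
      p continuous_on_norm[OF cont] by simp
  finally show ?thesis .
qed

text \<open>
  Averaging the circle inequality over all \<open>x\<close> in a ball gives the volume version, because the
  multiplication by \<open>cis s\<close> is an isometry and preserves the volume of the ball.
\<close>

lemma norm_powr_sub_mean_value:
  fixes h :: "complex ^ 'n \<Rightarrow> complex"
  assumes h: "mv_holomorphic_on h (ball w r)" and p: "1 < p"
  shows "ennreal (norm (h w) powr p) * emeasure lborel (ball w r)
    \<le> (\<integral>\<^sup>+y. indicator (ball w r) y * ennreal (norm (h y) powr p) \<partial>lborel)"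
proof -
  define f where "f = (\<lambda>y. indicator (ball w r) y * ennreal (norm (h y) powr p))"
  have f_meas [measurable]: "f \<in> borel_measurable borel"
    unfolding f_def using mv_holomorphic_imp_continuous_on[OF h] p
    by (intro borel_measurable_indicator_mult_ennreal) (auto intro!: continuous_intros continuous_on_powr')
  let ?e = "\<lambda>t x. w + cis (2 * pi * t) *s x"
  have e_meas [measurable]: "(\<lambda>y. f (?e (fst y) (snd y))) \<in> borel_measurable (borel \<Otimes>\<^sub>M borel)"
  proof (rule measurable_compose[OF _ f_meas])
    have "continuous_on UNIV (\<lambda>y :: real \<times> (complex ^ 'n). ?e (fst y) (snd y))"
      unfolding vector_scalar_mult_def by (intro continuous_intros)
    then show "(\<lambda>y. ?e (fst y) (snd y)) \<in> borel_measurable (borel \<Otimes>\<^sub>M borel)"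
      unfolding borel_prod by (rule borel_measurable_continuous_onI)
  qed
  have rot: "(\<integral>\<^sup>+x. f (?e t x) \<partial>lborel) = (\<integral>\<^sup>+y. f y \<partial>lborel)" for t
  proof -
    have "(\<integral>\<^sup>+x. f (?e t x) \<partial>lborel) = (\<integral>\<^sup>+x. f (w + x) \<partial>lborel)"
      by (rule nn_integral_lborel_isometry[where f="\<lambda>x. f (w + x)" and T="\<lambda>x. cis (2 * pi * t) *s x"])
         (auto simp: norm_scale_vec vec_eq_iff algebra_simps intro!: linearI)
    also have "\<dots> = (\<integral>\<^sup>+y. f y \<partial>lborel)"
      by (subst (2) nn_integral_lborel_affine[where c=1 and t=w]) simp_all
    finally show ?thesis .
  qed
  have "ennreal (norm (h w) powr p) * emeasure lborel (ball w r)
      = (\<integral>\<^sup>+x. ennreal (norm (h w) powr p) * indicator (ball (0 :: complex ^ 'n) r) x \<partial>lborel)"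
    by (cases "0 \<le> r") (auto simp: nn_integral_cmult_indicator emeasure_ball ball_empty)
  also have "\<dots> \<le> (\<integral>\<^sup>+x. (\<integral>\<^sup>+t. indicator {0..1} t * f (?e t x) \<partial>lborel) \<partial>lborel)"
  proof (rule nn_integral_mono)
    fix x :: "complex ^ 'n"
    show "ennreal (norm (h w) powr p) * indicator (ball 0 r) x \<le> (\<integral>\<^sup>+t. indicator {0..1} t * f (?e t x) \<partial>lborel)"
    proof (cases "norm x < r")
      case True
      then have in_ball: "?e t x \<in> ball w r" for t by (simp add: dist_norm norm_scale_vec)
      have "continuous_on {0..1} (\<lambda>t. h (?e t x))"
        by (rule continuous_on_compose2[OF mv_holomorphic_imp_continuous_on[OF h]])
           (use in_ball in \<open>auto intro!: continuous_intros bounded_linear.continuous_on[OF bounded_linear_scale_vec]\<close>)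
      then have "(\<integral>\<^sup>+t. indicator {0..1} t * f (?e t x) \<partial>lborel)
          = ennreal (integral {0..1} (\<lambda>t. norm (h (?e t x)) powr p))"
        using in_ball p
        by (subst nn_integral_eq_integral_continuous[symmetric])
           (auto simp: f_def intro!: continuous_intros continuous_on_powr')
      then show ?thesis
        using norm_powr_sub_mean_value_circle[OF h True p] True by (simp add: ennreal_leI)
    qed simp
  qed
  also have "\<dots> = (\<integral>\<^sup>+t. (\<integral>\<^sup>+x. indicator {0..1} t * f (?e t x) \<partial>lborel) \<partial>lborel)"
    by (rule lborel_pair.Fubini') measurable
  also have "\<dots> = (\<integral>\<^sup>+y. f y \<partial>lborel)"
    using rot by (simp add: nn_integral_cmult measurable_compose[OF _ e_meas, of "Pair _", simplified] nn_integral_multc)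
  finally show ?thesis by (simp add: f_def)
qed

section \<open>Cauchy estimates in weighted Bergman norms\<close>

lemma powr_le_of_comparable:
  fixes x y s :: real
  assumes "0 < x" "0 < y" "x \<le> 2 * y" "y \<le> 2 * x"
  shows "x powr s \<le> 2 powr \<bar>s\<bar> * y powr s"
proof (cases "0 \<le> s")
  case True
  have "x powr s \<le> (2 * y) powr s" using assms True by (intro powr_mono2) auto
  then show ?thesis using assms True by (simp add: powr_mult)
next
  case False
  have "x powr s \<le> (y / 2) powr s" using assms False by (intro powr_mono2') auto
  also have "(y / 2) powr s = 2 powr (- s) * y powr s"
    using assms by (simp add: powr_divide powr_minus_divide)
  finally show ?thesis using False by simp
qed

text \<open>
  Cauchy's inequality on a circle of radius \<open>r\<close>, where the values on the circle are estimated
  by volume means over balls of radius \<open>r\<close>; all of these lie in the ball of radius \<open>2 * r\<close>.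
\<close>

lemma partial_deriv_powr_le_nn_integral:
  fixes h :: "complex ^ 'n \<Rightarrow> complex"
  assumes h: "mv_holomorphic_on h (ball w (2 * r))" and r: "0 < r" and p: "1 < p"
  shows "ennreal (norm (partial_deriv h j w) powr p * (r powr p * (unit_ball_vol DIM(complex ^ 'n) * r ^ DIM(complex ^ 'n))))
    \<le> (\<integral>\<^sup>+y. indicator (ball w (2 * r)) y * ennreal (norm (h y) powr p) \<partial>lborel)" (is "_ \<le> ?Q")
proof (cases "?Q = \<infinity>")
  case True then show ?thesis by simp
next
  case False
  then obtain q where q: "?Q = ennreal q" "0 \<le> q" by (cases ?Q) auto
  define m where "m = unit_ball_vol DIM(complex ^ 'n) * r ^ DIM(complex ^ 'n)"
  have m: "0 < m" using r by (simp add: m_def)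
  define B where "B = (q / m) powr (1 / p)"
  have on_circle: "norm (h y) \<le> B" if y: "dist w y = r" for y
  proof -
    have sub: "ball y r \<subseteq> ball w (2 * r)"
      using y r by (intro ball_subset_ball_iff[THEN iffD2]) (simp add: dist_commute)
    have "ennreal (norm (h y) powr p * m) = ennreal (norm (h y) powr p) * emeasure lborel (ball y r)"
      using r by (simp add: emeasure_ball m_def ennreal_mult)
    also have "\<dots> \<le> (\<integral>\<^sup>+x. indicator (ball y r) x * ennreal (norm (h x) powr p) \<partial>lborel)"
      by (rule norm_powr_sub_mean_value[OF mv_holomorphic_on_subset[OF h sub] p])
    also have "\<dots> \<le> ?Q"
      using sub by (intro nn_integral_mono mult_right_mono) (auto simp: indicator_def)
    finally have "norm (h y) powr p * m \<le> q" using q by simp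
    then have "norm (h y) powr p \<le> q / m" using m by (simp add: field_simps)
    then have "(norm (h y) powr p) powr (1 / p) \<le> B"
      unfolding B_def using p by (intro powr_mono2) auto
    then show ?thesis using p by (simp add: powr_powr)
  qed
  define u where "u = (\<lambda>c. h (w + c *s axis j 1))"
  have in_ball: "w + c *s axis j 1 \<in> ball w (2 * r)" if "c \<in> ball 0 (2 * r)" for c
    using that by (simp add: dist_norm norm_scale_vec norm_axis_1)
  have u: "u holomorphic_on ball 0 (2 * r)"
    unfolding u_def by (rule slice_holomorphic[OF _ h in_ball]) auto
  have "norm ((deriv ^^ 1) u 0) \<le> fact 1 * B / r ^ 1"
  proof (rule Cauchy_inequality)
    show "u holomorphic_on ball 0 r" "continuous_on (cball 0 r) u"
      using u r by (auto intro: holomorphic_on_subset holomorphic_on_imp_continuous_on[THEN continuous_on_subset])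
    show "norm (u x) \<le> B" if "norm (0 - x) = r" for x
      unfolding u_def using that by (intro on_circle) (simp add: dist_norm norm_scale_vec norm_axis_1)
  qed (use r in auto)
  moreover have "deriv u 0 = partial_deriv h j w"
    using DERIV_imp_deriv[OF slice_has_field_derivative[OF _ h in_ball, of 0]] r
    by (simp add: sum_axis u_def)
  ultimately have "norm (partial_deriv h j w) * r \<le> B" using r by (simp add: field_simps)
  then have "(norm (partial_deriv h j w) * r) powr p \<le> B powr p"
    using r p by (intro powr_mono2) auto
  also have "B powr p = q / m" using q m p by (simp add: B_def powr_powr)
  finally have "norm (partial_deriv h j w) powr p * (r powr p * m) \<le> q"
    using m r by (simp add: powr_mult field_simps)
  then show ?thesis unfolding q(1) m_def[symmetric] by (rule ennreal_leI)
qed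

text \<open>
  The \<open>p\<close>-th power of a weighted Bergman norm. The weight is a power of the Euclidean distance to
  the boundary, which behaves better under dilations than the comparable \<open>1 - (norm z)\<^sup>2\<close>.
\<close>

definition bergman_pow :: "real \<Rightarrow> real \<Rightarrow> (complex ^ 'n \<Rightarrow> complex) \<Rightarrow> ennreal" where
  "bergman_pow \<beta> p f =
    (\<integral>\<^sup>+z. indicator unit_ball z * ennreal (norm (f z) powr p * (1 - norm z) powr \<beta>) \<partial>lborel)"

lemma bergman_integrand_measurable:
  fixes f :: "complex ^ 'n \<Rightarrow> complex"
  assumes "continuous_on unit_ball f" "0 < p"
  shows "(\<lambda>z. indicator unit_ball z * ennreal (norm (f z) powr p * (1 - norm z) powr \<beta>)) \<in> borel_measurable borel"
  using assms
  by (intro borel_measurable_indicator_mult_ennreal) (auto intro!: continuous_intros continuous_on_powr')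

lemma comparable_boundary_distance:
  fixes w y :: "'a::real_normed_vector"
  assumes "norm w < 1" "norm (w - y) < (1 - norm w) / 4"
  shows "norm y < 1" "1 - norm w \<le> 2 * (1 - norm y)" "1 - norm y \<le> 2 * (1 - norm w)"
    "norm (w - y) < (1 - norm y) / 2"
  using assms norm_triangle_ineq2[of w y] norm_triangle_ineq2[of y w] by (auto simp: norm_minus_commute)

text \<open>
  The preceding estimate at the scale of the distance to the boundary. On the ball of radius
  \<open>(1 - norm w) / 4\<close> around \<open>w\<close> the function \<open>1 - norm y\<close> is comparable to \<open>1 - norm w\<close>, so any
  power of it can be moved under the integral.
\<close>

lemma partial_deriv_powr_le_local:
  fixes p \<beta> :: real
  assumes p: "1 < p"
  shows "\<exists>C>0. \<forall>(h :: complex ^ 'n \<Rightarrow> complex) j w. mv_holomorphic_on h unit_ball \<longrightarrow> w \<in> unit_ball \<longrightarrow>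
    ennreal (norm (partial_deriv h j w) powr p * (1 - norm w) powr (\<beta> + p)) \<le>
    ennreal C * (\<integral>\<^sup>+y. indicator unit_ball y * ennreal (norm (h y) powr p * (1 - norm y) powr (\<beta> - DIM(complex ^ 'n)))
       * of_bool (norm (w - y) < (1 - norm w) / 4) \<partial>lborel)"
proof -
  let ?N = "DIM(complex ^ 'n)"
  define \<gamma> where "\<gamma> = \<beta> - ?N"
  define V where "V = unit_ball_vol ?N"
  have V: "0 < V" by (simp add: V_def)
  define C where "C = 8 powr (p + ?N) / V * 2 powr \<bar>\<gamma>\<bar>"
  have "ennreal (norm (partial_deriv h j w) powr p * (1 - norm w) powr (\<beta> + p)) \<le>
    ennreal C * (\<integral>\<^sup>+y. indicator unit_ball y * ennreal (norm (h y) powr p * (1 - norm y) powr \<gamma>)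
       * of_bool (norm (w - y) < (1 - norm w) / 4) \<partial>lborel)"
    if h: "mv_holomorphic_on h unit_ball" and w: "w \<in> unit_ball" for h :: "complex ^ 'n \<Rightarrow> complex" and j w
  proof -
    define d where "d = 1 - norm w"
    define r where "r = d / 8"
    have d: "0 < d" and r: "0 < r" using w by (auto simp: d_def r_def)
    have cmp: "norm y < 1" "d \<le> 2 * (1 - norm y)" "1 - norm y \<le> 2 * d" if "norm (w - y) < d / 4" for y
      using comparable_boundary_distance[of w y] w that by (auto simp: d_def)
    have ball_iff: "y \<in> ball w (2 * r) \<longleftrightarrow> norm (w - y) < d / 4" for y
      by (simp add: r_def dist_norm)
    have sub: "ball w (2 * r) \<subseteq> unit_ball" using cmp(1) ball_iff mem_ball_0 by blast
    have eq: "norm (partial_deriv h j w) powr p * d powr (\<beta> + p) =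
       8 powr (p + ?N) / V * d powr \<gamma> * (norm (partial_deriv h j w) powr p * (r powr p * (V * r ^ ?N)))"
    proof -
      have "r powr p * r ^ ?N = r powr (p + ?N)"
        using r by (simp add: powr_add powr_realpow del: DIM_cart)
      also have "\<dots> = d powr (p + ?N) / 8 powr (p + ?N)"
        using d unfolding r_def by (subst powr_divide) auto
      finally have rr: "r powr p * r ^ ?N = d powr (p + ?N) / 8 powr (p + ?N)" .
      have dd: "d powr \<gamma> * d powr (p + ?N) = d powr (\<beta> + p)"
        by (simp add: powr_add[symmetric] \<gamma>_def del: DIM_cart)
      have "8 powr (p + ?N) / V * d powr \<gamma> * (norm (partial_deriv h j w) powr p * (r powr p * (V * r ^ ?N)))
         = norm (partial_deriv h j w) powr p * (8 powr (p + ?N) * (d powr \<gamma> * (r powr p * r ^ ?N)))"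
        using V by (simp add: field_simps)
      also have "\<dots> = norm (partial_deriv h j w) powr p * (d powr \<gamma> * d powr (p + ?N))"
        unfolding rr by simp
      finally show ?thesis unfolding dd by (rule sym)
    qed
    have "ennreal (norm (partial_deriv h j w) powr p * d powr (\<beta> + p))
       = ennreal (8 powr (p + ?N) / V * d powr \<gamma>) * ennreal (norm (partial_deriv h j w) powr p * (r powr p * (V * r ^ ?N)))"
      unfolding eq using V by (intro ennreal_mult) (auto intro!: mult_nonneg_nonneg simp: r less_imp_le)
    also have "\<dots> \<le> ennreal (8 powr (p + ?N) / V * d powr \<gamma>) *
       (\<integral>\<^sup>+y. indicator (ball w (2 * r)) y * ennreal (norm (h y) powr p) \<partial>lborel)"
      unfolding V_def
      by (intro mult_left_mono partial_deriv_powr_le_nn_integral[OF mv_holomorphic_on_subset[OF h sub] r p]) auto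
    also have "\<dots> = ennreal (8 powr (p + ?N) / V) *
       (\<integral>\<^sup>+y. ennreal (d powr \<gamma>) * (indicator (ball w (2 * r)) y * ennreal (norm (h y) powr p)) \<partial>lborel)"
    proof -
      have "continuous_on (ball w (2 * r)) h"
        using mv_holomorphic_imp_continuous_on[OF h] sub continuous_on_subset by blast
      then have "(\<lambda>y. indicator (ball w (2 * r)) y * ennreal (norm (h y) powr p)) \<in> borel_measurable borel"
        using p by (intro borel_measurable_indicator_mult_ennreal) (auto intro!: continuous_intros continuous_on_powr')
      then show ?thesis
        using V ennreal_mult[of "8 powr (p + ?N) / V" "d powr \<gamma>"] by (simp add: nn_integral_cmult mult.assoc)
    qed
    also have "\<dots> \<le> ennreal (8 powr (p + ?N) / V) *
       (\<integral>\<^sup>+y. ennreal (2 powr \<bar>\<gamma>\<bar>) * (indicator unit_ball y * ennreal (norm (h y) powr p * (1 - norm y) powr \<gamma>)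
         * of_bool (norm (w - y) < d / 4)) \<partial>lborel)"
    proof (intro mult_left_mono nn_integral_mono)
      fix y
      show "ennreal (d powr \<gamma>) * (indicator (ball w (2 * r)) y * ennreal (norm (h y) powr p))
        \<le> ennreal (2 powr \<bar>\<gamma>\<bar>) * (indicator unit_ball y * ennreal (norm (h y) powr p * (1 - norm y) powr \<gamma>)
         * of_bool (norm (w - y) < d / 4))"
      proof (cases "norm (w - y) < d / 4")
        case True
        have "d powr \<gamma> * norm (h y) powr p \<le> 2 powr \<bar>\<gamma>\<bar> * (1 - norm y) powr \<gamma> * norm (h y) powr p"
          using cmp[OF True] d by (intro mult_right_mono powr_le_of_comparable) auto
        then show ?thesis using True cmp(1)[OF True] ball_iff[of y]
          by (simp add: ennreal_mult[symmetric] mult_ac)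
      next
        case False
        then show ?thesis using ball_iff[of y] by simp
      qed
    qed simp
    also have "\<dots> = ennreal C * (\<integral>\<^sup>+y. indicator unit_ball y * ennreal (norm (h y) powr p * (1 - norm y) powr \<gamma>)
         * of_bool (norm (w - y) < d / 4) \<partial>lborel)"
    proof -
      have [measurable]: "(\<lambda>y. indicator unit_ball y * ennreal (norm (h y) powr p * (1 - norm y) powr \<gamma>)) \<in> borel_measurable borel"
        using mv_holomorphic_imp_continuous_on[OF h] p by (intro bergman_integrand_measurable) auto
      have C_eq: "ennreal C = ennreal (8 powr (p + ?N) / V) * ennreal (2 powr \<bar>\<gamma>\<bar>)"
        unfolding C_def using V by (intro ennreal_mult) auto
      show ?thesis unfolding of_bool_def C_eq
        by (subst nn_integral_cmult) (measurable, simp only: mult.assoc)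
    qed
    finally show ?thesis by (simp add: d_def)
  qed
  moreover have "0 < C" using V by (simp add: C_def)
  ultimately show ?thesis unfolding \<gamma>_def by blast
qed

text \<open>
  One derivative costs one power of the distance to the boundary, in the weighted \<open>L\<^sup>p\<close> sense.
  This is the local estimate integrated in \<open>w\<close>: after Tonelli's theorem the inner integral is at
  most the volume of a ball around \<open>y\<close> of radius \<open>(1 - norm y) / 2\<close>, which cancels the power
  \<open>- DIM(complex ^ 'n)\<close> of the boundary distance.
\<close>

lemma bergman_pow_partial_deriv_le:
  fixes p \<beta> :: real
  assumes p: "1 < p"
  shows "\<exists>C>0. \<forall>(h :: complex ^ 'n \<Rightarrow> complex) j. mv_holomorphic_on h unit_ball \<longrightarrow>
    bergman_pow (\<beta> + p) p (partial_deriv h j) \<le> ennreal C * bergman_pow \<beta> p h"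
proof -
  let ?N = "DIM(complex ^ 'n)"
  obtain C where C: "0 < C" and le: "\<And>(h :: complex ^ 'n \<Rightarrow> complex) j w. mv_holomorphic_on h unit_ball \<Longrightarrow> w \<in> unit_ball \<Longrightarrow>
    ennreal (norm (partial_deriv h j w) powr p * (1 - norm w) powr (\<beta> + p)) \<le>
    ennreal C * (\<integral>\<^sup>+y. indicator unit_ball y * ennreal (norm (h y) powr p * (1 - norm y) powr (\<beta> - ?N))
       * of_bool (norm (w - y) < (1 - norm w) / 4) \<partial>lborel)"
    using partial_deriv_powr_le_local[OF p, of \<beta>, where 'n='n] by blast
  define V where "V = unit_ball_vol ?N"
  have V: "0 < V" by (simp add: V_def)
  have "bergman_pow (\<beta> + p) p (partial_deriv h j) \<le> ennreal (C * (V / 2 ^ ?N)) * bergman_pow \<beta> p h"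
    if h: "mv_holomorphic_on h unit_ball" for h :: "complex ^ 'n \<Rightarrow> complex" and j
  proof -
    define g where "g = (\<lambda>y. indicator unit_ball y * ennreal (norm (h y) powr p * (1 - norm y) powr (\<beta> - ?N)))"
    have g [measurable]: "g \<in> borel_measurable borel"
      unfolding g_def using mv_holomorphic_imp_continuous_on[OF h] p by (intro bergman_integrand_measurable) auto
    let ?k = "\<lambda>w y. of_bool (norm (w - y) < (1 - norm y) / 2) :: ennreal"
    have "bergman_pow (\<beta> + p) p (partial_deriv h j) \<le> (\<integral>\<^sup>+w. (\<integral>\<^sup>+y. ennreal C * (g y * ?k w y) \<partial>lborel) \<partial>lborel)"
      unfolding bergman_pow_def
    proof (rule nn_integral_mono)
      fix w :: "complex ^ 'n"
      show "indicator unit_ball w * ennreal (norm (partial_deriv h j w) powr p * (1 - norm w) powr (\<beta> + p))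
        \<le> (\<integral>\<^sup>+y. ennreal C * (g y * ?k w y) \<partial>lborel)"
      proof (cases "w \<in> unit_ball")
        case True
        have "indicator unit_ball w * ennreal (norm (partial_deriv h j w) powr p * (1 - norm w) powr (\<beta> + p))
          \<le> ennreal C * (\<integral>\<^sup>+y. g y * of_bool (norm (w - y) < (1 - norm w) / 4) \<partial>lborel)"
          using le[OF h True, of j] True by (simp add: g_def)
        also have "\<dots> \<le> ennreal C * (\<integral>\<^sup>+y. g y * ?k w y \<partial>lborel)"
          using comparable_boundary_distance(4)[of w] True
          by (intro mult_left_mono nn_integral_mono) auto
        also have "\<dots> = (\<integral>\<^sup>+y. ennreal C * (g y * ?k w y) \<partial>lborel)"
          by (subst nn_integral_cmult) (auto simp: of_bool_def)
        finally show ?thesis .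
      qed simp
    qed
    also have "\<dots> = (\<integral>\<^sup>+y. (\<integral>\<^sup>+w. ennreal C * (g y * ?k w y) \<partial>lborel) \<partial>lborel)"
      unfolding of_bool_def by (rule lborel_pair.Fubini') measurable
    also have "\<dots> \<le> (\<integral>\<^sup>+y. ennreal (C * (V / 2 ^ ?N)) *
        (indicator unit_ball y * ennreal (norm (h y) powr p * (1 - norm y) powr \<beta>)) \<partial>lborel)"
    proof (rule nn_integral_mono)
      fix y :: "complex ^ 'n"
      show "(\<integral>\<^sup>+w. ennreal C * (g y * ?k w y) \<partial>lborel)
        \<le> ennreal (C * (V / 2 ^ ?N)) * (indicator unit_ball y * ennreal (norm (h y) powr p * (1 - norm y) powr \<beta>))"
      proof (cases "y \<in> unit_ball")
        case True
        define d where "d = 1 - norm y"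
        have d: "0 < d" using True by (simp add: d_def)
        have "(\<integral>\<^sup>+w. ennreal C * (g y * ?k w y) \<partial>lborel) = (\<integral>\<^sup>+w. ennreal C * g y * indicator (ball y (d / 2)) w \<partial>lborel)"
          by (intro nn_integral_cong) (simp add: indicator_def d_def dist_norm norm_minus_commute mult.assoc)
        also have "\<dots> = ennreal C * g y * ennreal (V * (d / 2) ^ ?N)"
          using d by (simp add: nn_integral_cmult_indicator emeasure_ball V_def)
        also have "\<dots> = ennreal C * ennreal (norm (h y) powr p * d powr (\<beta> - ?N)) * ennreal (V * (d / 2) ^ ?N)"
          using True by (simp add: g_def d_def)
        also have "\<dots> = ennreal (C * (norm (h y) powr p * d powr (\<beta> - ?N)) * (V * (d / 2) ^ ?N))"
          using C V d by (simp add: ennreal_mult)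
        also have "C * (norm (h y) powr p * d powr (\<beta> - ?N)) * (V * (d / 2) ^ ?N) = C * (V / 2 ^ ?N) * (norm (h y) powr p * d powr \<beta>)"
        proof -
          have "d powr \<beta> = d powr (\<beta> - ?N) * d ^ ?N"
            using d by (simp add: powr_realpow[symmetric] powr_add[symmetric] del: DIM_cart)
          then show ?thesis by (simp add: power_divide)
        qed
        also have "ennreal (C * (V / 2 ^ ?N) * (norm (h y) powr p * d powr \<beta>)) =
            ennreal (C * (V / 2 ^ ?N)) * (indicator unit_ball y * ennreal (norm (h y) powr p * (1 - norm y) powr \<beta>))"
          using C V True by (subst ennreal_mult) (auto simp: d_def)
        finally show ?thesis by simp
      qed (simp add: g_def)
    qed
    also have "\<dots> = ennreal (C * (V / 2 ^ ?N)) * bergman_pow \<beta> p h"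
      unfolding bergman_pow_def using mv_holomorphic_imp_continuous_on[OF h] p
      by (intro nn_integral_cmult) (auto intro!: bergman_integrand_measurable)
    finally show ?thesis .
  qed
  moreover have "0 < C * (V / 2 ^ ?N)" using C V by simp
  ultimately show ?thesis by blast
qed

lemma partial_deriv_powr_le_near_0:
  fixes p \<beta> :: real
  assumes p: "1 < p"
  shows "\<exists>C>0. \<forall>(h :: complex ^ 'n \<Rightarrow> complex) j w. mv_holomorphic_on h unit_ball \<longrightarrow> norm w \<le> 1 / 2 \<longrightarrow>
    ennreal (norm (partial_deriv h j w) powr p) \<le> ennreal C * bergman_pow \<beta> p h"
proof -
  let ?N = "DIM(complex ^ 'n)"
  obtain C where C: "0 < C" and le: "\<And>(h :: complex ^ 'n \<Rightarrow> complex) j w. mv_holomorphic_on h unit_ball \<Longrightarrow> w \<in> unit_ball \<Longrightarrow>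
    ennreal (norm (partial_deriv h j w) powr p * (1 - norm w) powr (\<beta> + ?N + p)) \<le>
    ennreal C * (\<integral>\<^sup>+y. indicator unit_ball y * ennreal (norm (h y) powr p * (1 - norm y) powr (\<beta> + ?N - ?N))
       * of_bool (norm (w - y) < (1 - norm w) / 4) \<partial>lborel)"
    using partial_deriv_powr_le_local[OF p, of "\<beta> + ?N", where 'n='n] by blast
  \<comment> \<open>the shift by \<open>?N\<close> in the exponent leaves exactly the weight \<open>\<beta>\<close> under the integral\<close>
  define s where "s = \<beta> + ?N + p"
  have "ennreal (norm (partial_deriv h j w) powr p) \<le> ennreal (2 powr \<bar>s\<bar> * C) * bergman_pow \<beta> p h"
    if h: "mv_holomorphic_on h unit_ball" and w: "norm w \<le> 1 / 2" for h :: "complex ^ 'n \<Rightarrow> complex" and j w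
  proof -
    have "0 < 1 - norm w" using w by linarith
    moreover have "1 \<le> 2 * (1 - norm w)" using w by simp
    moreover have "1 - norm w \<le> 2 * 1" using norm_ge_zero[of w] by linarith
    ultimately have "1 powr s \<le> 2 powr \<bar>s\<bar> * (1 - norm w) powr s"
      by (intro powr_le_of_comparable) auto
    then have "norm (partial_deriv h j w) powr p * 1 \<le> norm (partial_deriv h j w) powr p * (2 powr \<bar>s\<bar> * (1 - norm w) powr s)"
      by (intro mult_left_mono) auto
    then have "ennreal (norm (partial_deriv h j w) powr p) \<le>
        ennreal (2 powr \<bar>s\<bar>) * ennreal (norm (partial_deriv h j w) powr p * (1 - norm w) powr s)"
      by (simp add: ennreal_mult[symmetric] mult_ac)
    also have "\<dots> \<le> ennreal (2 powr \<bar>s\<bar>) * (ennreal C * (\<integral>\<^sup>+y. indicator unit_ball y * ennreal (norm (h y) powr p * (1 - norm y) powr (\<beta> + ?N - ?N))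
       * of_bool (norm (w - y) < (1 - norm w) / 4) \<partial>lborel))"
      unfolding s_def using w by (intro mult_left_mono le[OF h]) auto
    also have "\<dots> \<le> ennreal (2 powr \<bar>s\<bar>) * (ennreal C * bergman_pow \<beta> p h)"
      unfolding bergman_pow_def by (intro mult_left_mono nn_integral_mono) auto
    finally show ?thesis using C by (simp add: ennreal_mult mult.assoc)
  qed
  moreover have "0 < 2 powr \<bar>s\<bar> * C" using C by simp
  ultimately show ?thesis by blast
qed

section \<open>Dilation averages and Hardy's inequality\<close>

lemma boundary_weight_nn_integral_le:
  fixes \<beta> r :: real
  assumes \<beta>: "-1 < \<beta>" and r: "0 \<le> r"
  shows "(\<integral>\<^sup>+t. indicator {1 / 2..1} t * (of_bool (r < t) * ennreal ((t - r) powr \<beta>)) \<partial>lborel)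
    \<le> of_bool (r < 1) * ennreal ((1 - r) powr (\<beta> + 1) / (\<beta> + 1))"
proof (cases "r < 1")
  case True
  have "(\<integral>\<^sup>+t. indicator {1 / 2..1} t * (of_bool (r < t) * ennreal ((t - r) powr \<beta>)) \<partial>lborel)
    \<le> (\<integral>\<^sup>+t. indicator {r..1} t * ennreal ((t - r) powr \<beta>) \<partial>lborel)"
    by (intro nn_integral_mono) (auto simp: indicator_def)
  also have "\<dots> = (\<integral>\<^sup>+s. indicator {r..1} (r + s) * ennreal ((r + s - r) powr \<beta>) \<partial>lborel)"
    by (subst nn_integral_lborel_affine[where c=1 and t=r]) simp_all
  also have "\<dots> = (\<integral>\<^sup>+s. ennreal (s powr \<beta>) * indicator {0..1 - r} s \<partial>lborel)"
    by (intro nn_integral_cong) (auto simp: indicator_def)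
  also have "\<dots> = ennreal ((1 - r) powr (\<beta> + 1) / (\<beta> + 1))"
    by (rule nn_integral_has_integral_lebesgue') (use True \<beta> in \<open>auto intro!: has_integral_powr_from_0\<close>)
  finally show ?thesis using True by simp
next
  case False
  then have "indicator {1 / 2..1} t * (of_bool (r < t) * ennreal ((t - r) powr \<beta>)) = 0" for t
    by (auto simp: indicator_def)
  then show ?thesis by (simp only: nn_integral_const) simp
qed

text \<open>
  Averaging over dilations gains one power of the distance to the boundary. For fixed \<open>t\<close> the
  substitution \<open>w = t z\<close> turns the weight into \<open>(1 - norm w / t) powr \<beta>\<close> on the ball of radius \<open>t\<close>,
  whose integral in \<open>t\<close> over \<open>norm w < t \<le> 1\<close> is at most of order \<open>(1 - norm w) powr (\<beta> + 1)\<close>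
  because \<open>\<beta> > - 1\<close>. This replaces integration in polar coordinates; keeping \<open>t \<ge> 1 / 2\<close> bounds
  the Jacobian.
\<close>

lemma dilation_average_le:
  fixes \<beta> :: real
  assumes \<beta>: "-1 < \<beta>"
  shows "\<exists>C>0. \<forall>u :: 'a::euclidean_space \<Rightarrow> ennreal. u \<in> borel_measurable borel \<longrightarrow>
    (\<integral>\<^sup>+z. indicator (ball 0 1) z * ennreal ((1 - norm z) powr \<beta>) *
        (\<integral>\<^sup>+t. indicator {1 / 2..1} t * u (t *\<^sub>R z) \<partial>lborel) \<partial>lborel)
    \<le> ennreal C * (\<integral>\<^sup>+w. indicator (ball 0 1) w * (ennreal ((1 - norm w) powr (\<beta> + 1)) * u w) \<partial>lborel)"
proof -
  let ?N = "DIM('a)"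
  define A where "A = 2 ^ ?N * 2 powr \<bar>\<beta>\<bar>"
  have A: "0 < A" by (simp add: A_def)
  have "(\<integral>\<^sup>+z. indicator (ball 0 1) z * ennreal ((1 - norm z) powr \<beta>) *
        (\<integral>\<^sup>+t. indicator {1 / 2..1} t * u (t *\<^sub>R z) \<partial>lborel) \<partial>lborel)
    \<le> ennreal (A / (\<beta> + 1)) * (\<integral>\<^sup>+w. indicator (ball 0 1) w * (ennreal ((1 - norm w) powr (\<beta> + 1)) * u w) \<partial>lborel)"
    if u [measurable]: "u \<in> borel_measurable borel" for u :: "'a \<Rightarrow> ennreal"
  proof -
    let ?I = "\<lambda>t. indicator {1 / 2..1::real} t :: ennreal"
    have B [measurable]: "ball (0::'a) 1 \<in> sets borel" by simp
    have "(\<integral>\<^sup>+z. indicator (ball 0 1) z * ennreal ((1 - norm z) powr \<beta>) *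
        (\<integral>\<^sup>+t. ?I t * u (t *\<^sub>R z) \<partial>lborel) \<partial>lborel)
      = (\<integral>\<^sup>+z. (\<integral>\<^sup>+t. indicator (ball 0 1) z * ennreal ((1 - norm z) powr \<beta>) * (?I t * u (t *\<^sub>R z)) \<partial>lborel) \<partial>lborel)"
      by (simp add: nn_integral_cmult)
    also have "\<dots> = (\<integral>\<^sup>+t. (\<integral>\<^sup>+z. indicator (ball 0 1) z * ennreal ((1 - norm z) powr \<beta>) * (?I t * u (t *\<^sub>R z)) \<partial>lborel) \<partial>lborel)"
      by (rule lborel_pair.Fubini'[symmetric]) measurable
    also have "\<dots> \<le> (\<integral>\<^sup>+t. (\<integral>\<^sup>+w. ennreal A * (?I t * (of_bool (norm w < t) * ennreal ((t - norm w) powr \<beta>)) * u w) \<partial>lborel) \<partial>lborel)"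
    proof (rule nn_integral_mono)
      fix t :: real
      show "(\<integral>\<^sup>+z. indicator (ball 0 1) z * ennreal ((1 - norm z) powr \<beta>) * (?I t * u (t *\<^sub>R z)) \<partial>lborel)
        \<le> (\<integral>\<^sup>+w. ennreal A * (?I t * (of_bool (norm w < t) * ennreal ((t - norm w) powr \<beta>)) * u w) \<partial>lborel)"
      proof (cases "t \<in> {1 / 2..1}")
        case True
        then have t: "1 / 2 \<le> t" "t \<le> 1" "0 < t" by auto
        define G where "G = (\<lambda>w :: 'a. of_bool (norm w < t) * ennreal (((t - norm w) / t) powr \<beta>) * u w)"
        have G [measurable]: "G \<in> borel_measurable borel" unfolding G_def of_bool_def by measurable
        have G_le: "G w \<le> ennreal (2 powr \<bar>\<beta>\<bar>) * (of_bool (norm w < t) * ennreal ((t - norm w) powr \<beta>) * u w)" for w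
        proof (cases "norm w < t")
          case True
          have "((t - norm w) / t) powr \<beta> \<le> 2 powr \<bar>\<beta>\<bar> * (t - norm w) powr \<beta>"
          proof (rule powr_le_of_comparable)
            show "(t - norm w) / t \<le> 2 * (t - norm w)"
              using mult_right_mono[OF t(1), of "2 * (t - norm w)"] True t by (simp add: field_simps)
            have "t - norm w \<le> (t - norm w) / t"
              using mult_left_mono[OF t(2), of "t - norm w"] True t by (simp add: field_simps)
            then show "t - norm w \<le> 2 * ((t - norm w) / t)"
              using True t by (smt (verit) divide_nonneg_pos)
          qed (use True t in auto)
          then show ?thesis using True
            by (auto simp: G_def ennreal_mult[symmetric] mult.assoc[symmetric] intro!: mult_right_mono ennreal_leI)
        qed (simp add: G_def)
        have "(1 / 2) ^ ?N \<le> t ^ ?N" using t by (intro power_mono) auto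
        then have "1 \<le> 2 ^ ?N * t ^ ?N" by (simp add: field_simps)
        then have one: "1 \<le> ennreal (2 ^ ?N) * ennreal (t ^ ?N)"
          using t by (simp add: ennreal_mult[symmetric])
        have "(\<integral>\<^sup>+z. indicator (ball 0 1) z * ennreal ((1 - norm z) powr \<beta>) * (?I t * u (t *\<^sub>R z)) \<partial>lborel)
            = (\<integral>\<^sup>+z. G (0 + t *\<^sub>R z) \<partial>lborel)"
        proof (rule nn_integral_cong)
          fix z :: 'a
          have "(t - norm (t *\<^sub>R z)) / t = 1 - norm z" "norm (t *\<^sub>R z) < t \<longleftrightarrow> norm z < 1"
            using t by (auto simp: diff_divide_distrib)
          then show "indicator (ball 0 1) z * ennreal ((1 - norm z) powr \<beta>) * (?I t * u (t *\<^sub>R z)) = G (0 + t *\<^sub>R z)"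
            using True by (simp add: G_def indicator_def)
        qed
        also have "\<dots> \<le> ennreal (2 ^ ?N) * ennreal (t ^ ?N) * (\<integral>\<^sup>+z. G (0 + t *\<^sub>R z) \<partial>lborel)"
          using mult_right_mono[OF one] by simp
        also have "\<dots> = ennreal (2 ^ ?N) * (\<integral>\<^sup>+w. G w \<partial>lborel)"
          using nn_integral_lborel_affine[OF G, of t 0] t by (simp add: mult.assoc)
        also have "\<dots> = (\<integral>\<^sup>+w. ennreal (2 ^ ?N) * G w \<partial>lborel)"
          by (simp add: nn_integral_cmult)
        also have "\<dots> \<le> (\<integral>\<^sup>+w. ennreal (2 ^ ?N) * (ennreal (2 powr \<bar>\<beta>\<bar>) * (of_bool (norm w < t) * ennreal ((t - norm w) powr \<beta>) * u w)) \<partial>lborel)"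
          by (intro nn_integral_mono mult_left_mono G_le) auto
        finally show ?thesis
          using True by (simp add: A_def ennreal_mult mult.assoc)
      qed simp
    qed
    also have "\<dots> = (\<integral>\<^sup>+w. (\<integral>\<^sup>+t. ennreal A * (?I t * (of_bool (norm w < t) * ennreal ((t - norm w) powr \<beta>)) * u w) \<partial>lborel) \<partial>lborel)"
      unfolding of_bool_def by (rule lborel_pair.Fubini') measurable
    also have "\<dots> \<le> (\<integral>\<^sup>+w. ennreal (A / (\<beta> + 1)) * (indicator (ball 0 1) w * (ennreal ((1 - norm w) powr (\<beta> + 1)) * u w)) \<partial>lborel)"
    proof (rule nn_integral_mono)
      fix w :: 'a
      have "(\<integral>\<^sup>+t. ennreal A * (?I t * (of_bool (norm w < t) * ennreal ((t - norm w) powr \<beta>)) * u w) \<partial>lborel)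
          = ennreal A * (\<integral>\<^sup>+t. ?I t * (of_bool (norm w < t) * ennreal ((t - norm w) powr \<beta>)) \<partial>lborel) * u w"
      proof -
        have m: "(\<lambda>t. ?I t * (of_bool (norm w < t) * ennreal ((t - norm w) powr \<beta>))) \<in> borel_measurable lborel"
          unfolding of_bool_def by measurable
        show ?thesis
          unfolding nn_integral_multc[OF m, symmetric] mult.assoc[of "ennreal A"]
          by (rule nn_integral_cmult[OF borel_measurable_times_ennreal[OF m borel_measurable_const]])
      qed
      also have "\<dots> \<le> ennreal A * (of_bool (norm w < 1) * ennreal ((1 - norm w) powr (\<beta> + 1) / (\<beta> + 1))) * u w"
        by (intro mult_left_mono mult_right_mono boundary_weight_nn_integral_le \<beta>) auto
      also have "\<dots> = ennreal (A / (\<beta> + 1)) * (indicator (ball 0 1) w * (ennreal ((1 - norm w) powr (\<beta> + 1)) * u w))"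
        using \<beta> A by (simp add: indicator_def ennreal_mult[symmetric] mult.assoc[symmetric] del: ennreal_mult)
      finally show "(\<integral>\<^sup>+t. ennreal A * (?I t * (of_bool (norm w < t) * ennreal ((t - norm w) powr \<beta>)) * u w) \<partial>lborel)
        \<le> ennreal (A / (\<beta> + 1)) * (indicator (ball 0 1) w * (ennreal ((1 - norm w) powr (\<beta> + 1)) * u w))" .
    qed
    also have "\<dots> = ennreal (A / (\<beta> + 1)) * (\<integral>\<^sup>+w. indicator (ball 0 1) w * (ennreal ((1 - norm w) powr (\<beta> + 1)) * u w) \<partial>lborel)"
      by (rule nn_integral_cmult) measurable
    finally show ?thesis .
  qed
  moreover have "0 < A / (\<beta> + 1)" using A \<beta> by simp
  ultimately show ?thesis by blast
qed

text \<open>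
  Dilation averaging applied to the constant function \<open>1\<close> bounds the integral with exponent \<open>\<beta>\<close>
  by the one with the nonnegative exponent \<open>\<beta> + 1\<close>.
\<close>

lemma weight_nn_integral_finite:
  fixes \<beta> :: real
  assumes \<beta>: "-1 < \<beta>"
  shows "(\<integral>\<^sup>+z. indicator (ball (0::'a::euclidean_space) 1) z * ennreal ((1 - norm z) powr \<beta>) \<partial>lborel) < \<infinity>" (is "?I < \<infinity>")
proof -
  have [measurable]: "ball (0::'a) 1 \<in> sets borel" by simp
  obtain C where C: "\<And>u :: 'a \<Rightarrow> ennreal. u \<in> borel_measurable borel \<Longrightarrow>
    (\<integral>\<^sup>+z. indicator (ball 0 1) z * ennreal ((1 - norm z) powr \<beta>) *
        (\<integral>\<^sup>+t. indicator {1 / 2..1} t * u (t *\<^sub>R z) \<partial>lborel) \<partial>lborel)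
    \<le> ennreal C * (\<integral>\<^sup>+w. indicator (ball 0 1) w * (ennreal ((1 - norm w) powr (\<beta> + 1)) * u w) \<partial>lborel)"
    using dilation_average_le[OF \<beta>, where 'a='a] by blast
  have "?I * ennreal (1 / 2) = (\<integral>\<^sup>+z. indicator (ball (0::'a) 1) z * ennreal ((1 - norm z) powr \<beta>) *
      (\<integral>\<^sup>+t. indicator {1 / 2..1::real} t * 1 \<partial>lborel) \<partial>lborel)"
    by (simp add: nn_integral_multc)
  also have "\<dots> \<le> ennreal C * (\<integral>\<^sup>+w. indicator (ball (0::'a) 1) w * (ennreal ((1 - norm w) powr (\<beta> + 1)) * 1) \<partial>lborel)"
    by (rule C) simp
  also have "\<dots> \<le> ennreal C * (\<integral>\<^sup>+w. indicator (ball (0::'a) 1) w \<partial>lborel)"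
  proof (intro mult_left_mono nn_integral_mono)
    fix w :: 'a
    have "(1 - norm w) powr (\<beta> + 1) \<le> 1" if "norm w < 1"
      using that \<beta> by (intro powr_le1) auto
    then show "indicator (ball 0 1) w * (ennreal ((1 - norm w) powr (\<beta> + 1)) * 1) \<le> indicator (ball 0 1) w"
      by (auto simp: indicator_def)
  qed simp
  also have "\<dots> < \<infinity>" by (simp add: emeasure_ball ennreal_mult[symmetric] ennreal_mult_less_top)
  finally show ?thesis by (auto simp: ennreal_mult_less_top ennreal_mult_top less_top[symmetric])
qed

lemma continuous_on_radial_integral:
  fixes u :: "'a::euclidean_space \<Rightarrow> 'b::euclidean_space"
  assumes u: "continuous_on (ball 0 1) u" and ab: "0 \<le> a" "b \<le> 1"
  shows "continuous_on (ball 0 1) (\<lambda>z. integral {a..b} (\<lambda>t. u (t *\<^sub>R z)))"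
    and "z \<in> ball 0 1 \<Longrightarrow> continuous_on {a..b} (\<lambda>t. u (t *\<^sub>R z))"
proof -
  have in_ball: "t *\<^sub>R z \<in> ball 0 1" if "z \<in> ball 0 1" "t \<in> {a..b}" for t and z :: 'a
    using that ab mult_le_one[of t "norm z"] mult_left_le_one_le[of "norm z" "\<bar>t\<bar>"] by auto
  have "continuous_on (ball 0 1 \<times> cbox a b) (\<lambda>(z, t). u (t *\<^sub>R z))"
    unfolding split_beta by (rule continuous_on_compose2[OF u]) (use in_ball in \<open>auto intro!: continuous_intros\<close>)
  from integral_continuous_on_param[OF this]
  show "continuous_on (ball 0 1) (\<lambda>z. integral {a..b} (\<lambda>t. u (t *\<^sub>R z)))" by simp
  show "continuous_on {a..b} (\<lambda>t. u (t *\<^sub>R z))" if "z \<in> ball 0 1"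
    by (rule continuous_on_compose2[OF u]) (use in_ball[OF that] in \<open>auto intro!: continuous_intros\<close>)
qed

text \<open>
  Jensen's inequality along a radius with density \<open>((1 - t) + (1 - norm z)) powr (- e - 1)\<close>,
  whose mass is at most of order \<open>(1 - norm z) powr (- e)\<close>. The base of this density is at most
  \<open>2 * (1 - norm (t *\<^sub>R z))\<close>, so the right-hand side is a dilation average up to constants.
\<close>

lemma radial_hardy_pointwise:
  fixes u :: "'a::euclidean_space \<Rightarrow> real" and p e :: real
  assumes u: "continuous_on (ball 0 1) u" "\<And>w. 0 \<le> u w" and p: "1 < p" and e: "0 < e" and z: "norm z < 1"
  shows "integral {1 / 2..1} (\<lambda>t. u (t *\<^sub>R z)) powr p \<le>
    (1 / e) powr (p - 1) * 2 powr ((1 + e) * (p - 1)) * (1 - norm z) powr (- e * (p - 1)) *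
    integral {1 / 2..1} (\<lambda>t. u (t *\<^sub>R z) powr p * (1 - norm (t *\<^sub>R z)) powr ((1 + e) * (p - 1)))"
proof -
  define x where "x = 1 - norm z"
  have x: "0 < x" using z by (simp add: x_def)
  define k where "k = (\<lambda>t. ((1 - t) + x) powr (- e - 1))"
  define K where "K = x powr (- e) / e"
  have pos: "0 < (1 - t) + x" if "t \<in> {1 / 2..1}" for t using that x by auto
  have ucont: "continuous_on {1 / 2..1} (\<lambda>t. u (t *\<^sub>R z))"
    using z by (intro continuous_on_radial_integral(2)[OF u(1)]) auto
  have kcont: "continuous_on {1 / 2..1} k"
    unfolding k_def using pos by (intro continuous_intros) (auto simp: less_imp_neq[symmetric] intro: less_imp_neq[symmetric])
  have "(k has_integral (((1 - 1) + x) powr (- e) / e - ((1 - 1 / 2) + x) powr (- e) / e)) {1 / 2..1}"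
  proof (rule fundamental_theorem_of_calculus)
    fix t :: real assume "t \<in> {1 / 2..1}"
    from pos[OF this] show "((\<lambda>t. ((1 - t) + x) powr (- e) / e) has_vector_derivative k t) (at t within {1 / 2..1})"
      unfolding has_real_derivative_iff_has_vector_derivative[symmetric] k_def using e
      by (auto intro!: derivative_eq_intros simp: field_simps)
  qed simp
  then have K_le: "integral {1 / 2..1} k \<le> K"
    using e by (simp add: integral_unique K_def)
  have "integral {1 / 2..1} (\<lambda>t. u (t *\<^sub>R z)) powr p \<le>
      K powr (p - 1) * integral {1 / 2..1} (\<lambda>t. u (t *\<^sub>R z) powr p * k t powr (1 - p))"
    by (rule weighted_jensen[OF ucont _ kcont _ p K_le])
       (use u pos x e in \<open>auto simp: k_def K_def powr_gt_zero less_imp_neq[symmetric] intro: less_imp_neq[symmetric]\<close>)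
  also have "\<dots> \<le> K powr (p - 1) * (2 powr ((1 + e) * (p - 1)) *
    integral {1 / 2..1} (\<lambda>t. u (t *\<^sub>R z) powr p * (1 - norm (t *\<^sub>R z)) powr ((1 + e) * (p - 1))))"
  proof (rule mult_left_mono)
    show "integral {1 / 2..1} (\<lambda>t. u (t *\<^sub>R z) powr p * k t powr (1 - p)) \<le> 2 powr ((1 + e) * (p - 1)) *
      integral {1 / 2..1} (\<lambda>t. u (t *\<^sub>R z) powr p * (1 - norm (t *\<^sub>R z)) powr ((1 + e) * (p - 1)))"
      unfolding integral_mult_right[symmetric]
    proof (rule integral_le)
      have tz: "norm (t *\<^sub>R z) < 1" if "t \<in> {1 / 2..1}" for t
        using that z mult_left_le_one_le[of "norm z" t] by auto
      show "(\<lambda>t. u (t *\<^sub>R z) powr p * k t powr (1 - p)) integrable_on {1 / 2..1}"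
        using u p ucont kcont pos
        by (intro integrable_continuous_real continuous_intros continuous_on_powr') (auto simp: k_def less_imp_neq[symmetric] intro: less_imp_neq[symmetric])
      show "(\<lambda>t. 2 powr ((1 + e) * (p - 1)) *
        (u (t *\<^sub>R z) powr p * (1 - norm (t *\<^sub>R z)) powr ((1 + e) * (p - 1)))) integrable_on {1 / 2..1}"
        using u p ucont tz
        by (intro integrable_continuous_real continuous_intros continuous_on_powr') (auto simp: less_imp_neq[symmetric] intro: less_imp_neq[symmetric])
      fix t :: real assume t: "t \<in> {1 / 2..1}"
      have le: "(1 - t) + x \<le> 2 * (1 - norm (t *\<^sub>R z))"
      proof -
        have "t * norm z \<le> t" using z t by (intro mult_left_le) auto
        moreover have "t * norm z \<le> norm z" using z t by (intro mult_left_le_one_le) auto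
        ultimately have "(1 - t) + (1 - norm z) \<le> 2 * (1 - t * norm z)" by argo
        then show ?thesis using t by (simp add: x_def)
      qed
      have "k t powr (1 - p) = ((1 - t) + x) powr ((1 + e) * (p - 1))"
        by (simp add: k_def powr_powr algebra_simps)
      also have "\<dots> \<le> (2 * (1 - norm (t *\<^sub>R z))) powr ((1 + e) * (p - 1))"
        using le pos[OF t] p e by (intro powr_mono2) auto
      also have "\<dots> = 2 powr ((1 + e) * (p - 1)) * (1 - norm (t *\<^sub>R z)) powr ((1 + e) * (p - 1))"
        using tz[OF t] by (intro powr_mult)
      finally have "u (t *\<^sub>R z) powr p * k t powr (1 - p) \<le> u (t *\<^sub>R z) powr p *
          (2 powr ((1 + e) * (p - 1)) * (1 - norm (t *\<^sub>R z)) powr ((1 + e) * (p - 1)))"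
        by (intro mult_left_mono) auto
      then show "u (t *\<^sub>R z) powr p * k t powr (1 - p) \<le> 2 powr ((1 + e) * (p - 1)) *
        (u (t *\<^sub>R z) powr p * (1 - norm (t *\<^sub>R z)) powr ((1 + e) * (p - 1)))"
        by (simp only: mult_ac)
    qed
  qed simp
  also have "K powr (p - 1) = (1 / e) powr (p - 1) * x powr (- e * (p - 1))"
    using x e by (simp add: K_def powr_divide powr_powr)
  finally show ?thesis unfolding x_def by (simp only: mult_ac)
qed

text \<open>
  Hardy's inequality for integrals along radii: the pointwise bound, multiplied by the weight,
  is integrated with the help of dilation averaging. The parameter \<open>e\<close> has to be so small that the
  remaining exponent \<open>\<alpha> - e * (p - 1)\<close> stays above \<open>- 1\<close>; this is possible as \<open>\<alpha> > - 1\<close>.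
\<close>

lemma radial_hardy:
  fixes p \<alpha> :: real
  assumes p: "1 < p" and \<alpha>: "-1 < \<alpha>"
  shows "\<exists>C>0. \<forall>u :: 'a::euclidean_space \<Rightarrow> real. continuous_on (ball 0 1) u \<longrightarrow> (\<forall>w. 0 \<le> u w) \<longrightarrow>
    (\<integral>\<^sup>+z. indicator (ball 0 1) z * ennreal (integral {1 / 2..1} (\<lambda>t. u (t *\<^sub>R z)) powr p * (1 - norm z) powr \<alpha>) \<partial>lborel)
    \<le> ennreal C * (\<integral>\<^sup>+w. indicator (ball 0 1) w * ennreal (u w powr p * (1 - norm w) powr (\<alpha> + p)) \<partial>lborel)"
proof -
  \<comment> \<open>then \<open>e * (p - 1) < (1 + \<alpha>) / 2\<close>, which leaves room above \<open>- 1\<close> in the exponent \<open>\<beta>\<close>\<close>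
  define e where "e = (1 + \<alpha>) / (2 * p)"
  have e: "0 < e" using \<alpha> p by (simp add: e_def)
  define \<beta> where "\<beta> = \<alpha> - e * (p - 1)"
  have "e * p = (1 + \<alpha>) / 2" using p by (simp add: e_def)
  then have \<beta>: "-1 < \<beta>" unfolding \<beta>_def using \<alpha> e by (simp add: algebra_simps)
  define s where "s = (1 + e) * (p - 1)"
  have exps: "\<beta> + 1 + s = \<alpha> + p" by (simp add: \<beta>_def s_def algebra_simps)
  define A where "A = (1 / e) powr (p - 1) * 2 powr s"
  have A: "0 < A" using e by (simp add: A_def)
  obtain C where C: "0 < C" and dil: "\<And>u :: 'a \<Rightarrow> ennreal. u \<in> borel_measurable borel \<Longrightarrow>
    (\<integral>\<^sup>+z. indicator (ball 0 1) z * ennreal ((1 - norm z) powr \<beta>) *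
        (\<integral>\<^sup>+t. indicator {1 / 2..1} t * u (t *\<^sub>R z) \<partial>lborel) \<partial>lborel)
    \<le> ennreal C * (\<integral>\<^sup>+w. indicator (ball 0 1) w * (ennreal ((1 - norm w) powr (\<beta> + 1)) * u w) \<partial>lborel)"
    using dilation_average_le[OF \<beta>, where 'a='a] by blast
  have "(\<integral>\<^sup>+z. indicator (ball 0 1) z * ennreal (integral {1 / 2..1} (\<lambda>t. u (t *\<^sub>R z)) powr p * (1 - norm z) powr \<alpha>) \<partial>lborel)
    \<le> ennreal (A * C) * (\<integral>\<^sup>+w. indicator (ball 0 1) w * ennreal (u w powr p * (1 - norm w) powr (\<alpha> + p)) \<partial>lborel)"
    if u: "continuous_on (ball 0 1) u" "\<And>w. 0 \<le> u w" for u :: "'a \<Rightarrow> real"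
  proof -
    define g where "g = (\<lambda>w. indicator (ball 0 1) w * ennreal (u w powr p * (1 - norm w) powr s))"
    have g [measurable]: "g \<in> borel_measurable borel"
      unfolding g_def using u p
      by (intro borel_measurable_indicator_mult_ennreal) (auto intro!: continuous_intros continuous_on_powr')
    have [measurable]: "ball (0::'a) 1 \<in> sets borel" by simp
    have "(\<integral>\<^sup>+z. indicator (ball 0 1) z * ennreal (integral {1 / 2..1} (\<lambda>t. u (t *\<^sub>R z)) powr p * (1 - norm z) powr \<alpha>) \<partial>lborel)
      \<le> (\<integral>\<^sup>+z. ennreal A * (indicator (ball 0 1) z * ennreal ((1 - norm z) powr \<beta>) *
          (\<integral>\<^sup>+t. indicator {1 / 2..1} t * g (t *\<^sub>R z) \<partial>lborel)) \<partial>lborel)"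
    proof (rule nn_integral_mono)
      fix z :: 'a
      show "indicator (ball 0 1) z * ennreal (integral {1 / 2..1} (\<lambda>t. u (t *\<^sub>R z)) powr p * (1 - norm z) powr \<alpha>)
        \<le> ennreal A * (indicator (ball 0 1) z * ennreal ((1 - norm z) powr \<beta>) *
          (\<integral>\<^sup>+t. indicator {1 / 2..1} t * g (t *\<^sub>R z) \<partial>lborel))"
      proof (cases "norm z < 1")
        case True
        let ?J = "integral {1 / 2..1} (\<lambda>t. u (t *\<^sub>R z) powr p * (1 - norm (t *\<^sub>R z)) powr s)"
        have tz: "norm (t *\<^sub>R z) < 1" if "t \<in> {1 / 2..1}" for t
          using that True mult_left_le_one_le[of "norm z" t] by auto
        have "continuous_on (ball 0 1) (\<lambda>w. u w powr p * (1 - norm w) powr s)"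
          using u p by (auto intro!: continuous_intros continuous_on_powr')
        then have cont: "continuous_on {1 / 2..1} (\<lambda>t. u (t *\<^sub>R z) powr p * (1 - norm (t *\<^sub>R z)) powr s)"
          using True by (intro continuous_on_radial_integral(2)) auto
        have "(\<integral>\<^sup>+t. indicator {1 / 2..1} t * g (t *\<^sub>R z) \<partial>lborel) = (\<integral>\<^sup>+t. indicator {1 / 2..1} t *
            ennreal (u (t *\<^sub>R z) powr p * (1 - norm (t *\<^sub>R z)) powr s) \<partial>lborel)"
          using tz by (intro nn_integral_cong) (auto simp: g_def indicator_def)
        also have "\<dots> = ennreal ?J"
          by (rule nn_integral_eq_integral_continuous[OF cont]) auto
        finally have J: "(\<integral>\<^sup>+t. indicator {1 / 2..1} t * g (t *\<^sub>R z) \<partial>lborel) = ennreal ?J" .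
        have J0: "0 \<le> ?J" by (intro integral_nonneg integrable_continuous_real cont) auto
        have "integral {1 / 2..1} (\<lambda>t. u (t *\<^sub>R z)) powr p * (1 - norm z) powr \<alpha>
          \<le> A * (1 - norm z) powr (- e * (p - 1)) * ?J * (1 - norm z) powr \<alpha>"
          unfolding A_def s_def by (intro mult_right_mono radial_hardy_pointwise[OF u p e True]) auto
        also have "\<dots> = A * ((1 - norm z) powr \<beta> * ?J)"
          by (simp add: \<beta>_def powr_diff powr_minus_divide mult_ac)
        finally have "ennreal (integral {1 / 2..1} (\<lambda>t. u (t *\<^sub>R z)) powr p * (1 - norm z) powr \<alpha>)
          \<le> ennreal (A * ((1 - norm z) powr \<beta> * ?J))" by (rule ennreal_leI)
        also have "\<dots> = ennreal A * (ennreal ((1 - norm z) powr \<beta>) * ennreal ?J)"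
          using A J0 by (simp only: ennreal_mult mult_nonneg_nonneg powr_ge_zero less_imp_le)
        finally show ?thesis using True by (simp add: J)
      qed simp
    qed
    also have "\<dots> = ennreal A * (\<integral>\<^sup>+z. indicator (ball 0 1) z * ennreal ((1 - norm z) powr \<beta>) *
          (\<integral>\<^sup>+t. indicator {1 / 2..1} t * g (t *\<^sub>R z) \<partial>lborel) \<partial>lborel)"
      by (rule nn_integral_cmult) measurable
    also have "\<dots> \<le> ennreal A * (ennreal C * (\<integral>\<^sup>+w. indicator (ball 0 1) w * (ennreal ((1 - norm w) powr (\<beta> + 1)) * g w) \<partial>lborel))"
      by (intro mult_left_mono dil g) auto
    also have "(\<integral>\<^sup>+w. indicator (ball 0 1) w * (ennreal ((1 - norm w) powr (\<beta> + 1)) * g w) \<partial>lborel)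
      = (\<integral>\<^sup>+w. indicator (ball 0 1) w * ennreal (u w powr p * (1 - norm w) powr (\<alpha> + p)) \<partial>lborel)"
      by (intro nn_integral_cong)
         (auto simp: g_def indicator_def exps[symmetric] powr_add ennreal_mult[symmetric] mult_ac)
    finally show ?thesis using A C by (simp add: ennreal_mult mult.assoc)
  qed
  moreover have "0 < A * C" using A C by simp
  ultimately show ?thesis by blast
qed

text \<open>
  The analytic core of the theorem. Integrating a derivative along radii undoes the loss caused by
  differentiation: near the boundary (\<open>t \<ge> 1 / 2\<close>) Hardy's inequality brings in
  \<open>bergman_pow (\<alpha> + p)\<close> of the derivative, which Cauchy's estimate controls by \<open>bergman_pow \<alpha>\<close> of
  the function. For \<open>t \<le> 1 / 2\<close> only points with \<open>norm (t *\<^sub>R z) \<le> 1 / 2\<close> occur, and there the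
  derivative is bounded outright.
\<close>

lemma radial_integral_partial_deriv_le:
  fixes p \<alpha> :: real
  assumes p: "1 < p" and \<alpha>: "-1 < \<alpha>"
  shows "\<exists>C>0. \<forall>(h :: complex ^ 'n \<Rightarrow> complex) j. mv_holomorphic_on h unit_ball \<longrightarrow>
    (\<integral>\<^sup>+z. indicator unit_ball z *
       ennreal (integral {0..1} (\<lambda>t. norm (partial_deriv h j (t *\<^sub>R z))) powr p * (1 - norm z) powr \<alpha>) \<partial>lborel)
    \<le> ennreal C * bergman_pow \<alpha> p h"
proof -
  obtain C1 where C1: "0 < C1" and near_0: "\<And>(h :: complex ^ 'n \<Rightarrow> complex) j w. mv_holomorphic_on h unit_ball \<Longrightarrow> norm w \<le> 1 / 2 \<Longrightarrow>
    ennreal (norm (partial_deriv h j w) powr p) \<le> ennreal C1 * bergman_pow \<alpha> p h"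
    using partial_deriv_powr_le_near_0[OF p, of \<alpha>, where 'n='n] by blast
  obtain C2 where C2: "0 < C2" and cauchy: "\<And>(h :: complex ^ 'n \<Rightarrow> complex) j. mv_holomorphic_on h unit_ball \<Longrightarrow>
    bergman_pow (\<alpha> + p) p (partial_deriv h j) \<le> ennreal C2 * bergman_pow \<alpha> p h"
    using bergman_pow_partial_deriv_le[OF p, of \<alpha>, where 'n='n] by blast
  obtain C3 where C3: "0 < C3" and hardy: "\<And>u :: complex ^ 'n \<Rightarrow> real. continuous_on unit_ball u \<Longrightarrow> (\<And>w. 0 \<le> u w) \<Longrightarrow>
    (\<integral>\<^sup>+z. indicator unit_ball z * ennreal (integral {1 / 2..1} (\<lambda>t. u (t *\<^sub>R z)) powr p * (1 - norm z) powr \<alpha>) \<partial>lborel)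
    \<le> ennreal C3 * (\<integral>\<^sup>+w. indicator unit_ball w * ennreal (u w powr p * (1 - norm w) powr (\<alpha> + p)) \<partial>lborel)"
    using radial_hardy[OF p \<alpha>, where 'a="complex ^ 'n"] by blast
  obtain W where W: "(\<integral>\<^sup>+z. indicator (unit_ball :: (complex ^ 'n) set) z * ennreal ((1 - norm z) powr \<alpha>) \<partial>lborel) = ennreal W" "0 \<le> W"
    using weight_nn_integral_finite[OF \<alpha>, where 'a="complex ^ 'n"]
    by (cases "\<integral>\<^sup>+z. indicator (unit_ball :: (complex ^ 'n) set) z * ennreal ((1 - norm z) powr \<alpha>) \<partial>lborel") auto
  define C where "C = 2 powr p * (C1 * W + C3 * C2)"
  have "(\<integral>\<^sup>+z. indicator unit_ball z *
       ennreal (integral {0..1} (\<lambda>t. norm (partial_deriv h j (t *\<^sub>R z))) powr p * (1 - norm z) powr \<alpha>) \<partial>lborel)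
    \<le> ennreal C * bergman_pow \<alpha> p h"
    if h: "mv_holomorphic_on h unit_ball" for h :: "complex ^ 'n \<Rightarrow> complex" and j
  proof -
    define u where "u = (\<lambda>w. norm (partial_deriv h j w))"
    have u: "continuous_on unit_ball u" "\<And>w. 0 \<le> u w"
      unfolding u_def using continuous_on_partial_deriv[OF _ h] by (auto intro!: continuous_intros)
    define Q where "Q = bergman_pow \<alpha> p h"
    let ?Y = "\<lambda>z. integral {1 / 2..1} (\<lambda>t. u (t *\<^sub>R z))"
    have Ycont: "continuous_on unit_ball ?Y" by (rule continuous_on_radial_integral(1)[OF u(1)]) auto
    have [measurable]: "(\<lambda>z. indicator unit_ball z * ennreal (?Y z powr p * (1 - norm z) powr \<alpha>)) \<in> borel_measurable borel"
    proof (rule borel_measurable_indicator_mult_ennreal)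
      have "0 \<le> ?Y z" if "z \<in> unit_ball" for z
        by (intro integral_nonneg integrable_continuous_real continuous_on_radial_integral(2)[OF u(1)])
           (use u that in auto)
      then show "continuous_on unit_ball (\<lambda>z. ?Y z powr p * (1 - norm z) powr \<alpha>)"
        using Ycont p by (auto intro!: continuous_intros continuous_on_powr')
    qed simp
    have [measurable]: "unit_ball \<in> sets (borel :: (complex ^ 'n) measure)" by simp
    have ptw: "indicator unit_ball z * ennreal (integral {0..1} (\<lambda>t. u (t *\<^sub>R z)) powr p * (1 - norm z) powr \<alpha>)
       \<le> ennreal (2 powr p) * (ennreal C1 * Q * (indicator unit_ball z * ennreal ((1 - norm z) powr \<alpha>))
         + indicator unit_ball z * ennreal (?Y z powr p * (1 - norm z) powr \<alpha>))" for z
    proof (cases "z \<in> unit_ball")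
      case True
      let ?X = "integral {0..1 / 2} (\<lambda>t. u (t *\<^sub>R z))"
      have cont: "continuous_on {0..1} (\<lambda>t. u (t *\<^sub>R z))"
        by (rule continuous_on_radial_integral(2)[OF u(1)]) (use True in auto)
      have cX: "continuous_on {0..1 / 2} (\<lambda>t. u (t *\<^sub>R z))" and cY: "continuous_on {1 / 2..1} (\<lambda>t. u (t *\<^sub>R z))"
        by (rule continuous_on_subset[OF cont]; auto)+
      have XY: "integral {0..1} (\<lambda>t. u (t *\<^sub>R z)) = ?X + ?Y z"
        by (rule Henstock_Kurzweil_Integration.integral_combine[symmetric])
           (auto intro: integrable_continuous_real cont)
      have X0: "0 \<le> ?X" and Y0: "0 \<le> ?Y z"
        using u by (auto intro!: integral_nonneg integrable_continuous_real cX cY)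
      have X_le: "ennreal (?X powr p) \<le> ennreal C1 * Q"
      proof (cases "Q = \<infinity>")
        case True then show ?thesis using C1 by (simp add: ennreal_mult_top)
      next
        case False
        then obtain q where q: "Q = ennreal q" "0 \<le> q" by (cases Q) auto
        define B where "B = (C1 * q) powr (1 / p)"
        have "u (t *\<^sub>R z) \<le> B" if "t \<in> {0..1 / 2}" for t
        proof -
          have "norm (t *\<^sub>R z) \<le> 1 / 2 * 1" unfolding norm_scaleR
            using that True by (intro mult_mono) auto
          then have "ennreal (u (t *\<^sub>R z) powr p) \<le> ennreal C1 * Q"
            unfolding u_def Q_def by (intro near_0[OF h]) simp
          then have "u (t *\<^sub>R z) powr p \<le> C1 * q"
            using q C1 by (simp add: ennreal_mult[symmetric])
          then have "(u (t *\<^sub>R z) powr p) powr (1 / p) \<le> B"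
            unfolding B_def using p by (intro powr_mono2) auto
          then show ?thesis using p u by (simp add: powr_powr)
        qed
        then have "?X \<le> integral {0..1 / 2::real} (\<lambda>t. B)"
          by (intro integral_le integrable_continuous_real cX) auto
        also have "\<dots> \<le> B" by (simp add: B_def)
        finally have "?X powr p \<le> B powr p" using X0 p by (intro powr_mono2) auto
        also have "B powr p = C1 * q" using C1 q p by (simp add: B_def powr_powr)
        finally show ?thesis using q C1 by (simp add: ennreal_mult[symmetric])
      qed
      have "(?X + ?Y z) powr p \<le> (2 * max ?X (?Y z)) powr p"
        using X0 Y0 p by (intro powr_mono2) auto
      also have "\<dots> = 2 powr p * max ?X (?Y z) powr p" using X0 by (intro powr_mult)
      also have "\<dots> \<le> 2 powr p * (?X powr p + ?Y z powr p)"
        by (intro mult_left_mono) (auto simp: max_def)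
      finally have "ennreal ((?X + ?Y z) powr p * (1 - norm z) powr \<alpha>)
         \<le> ennreal (2 powr p * (?X powr p + ?Y z powr p) * (1 - norm z) powr \<alpha>)"
        by (intro ennreal_leI mult_right_mono) auto
      also have "\<dots> = ennreal (2 powr p) * (ennreal (?X powr p) * ennreal ((1 - norm z) powr \<alpha>)
           + ennreal (?Y z powr p * (1 - norm z) powr \<alpha>))"
        by (simp add: ennreal_mult ennreal_plus distrib_left distrib_right mult.assoc)
      also have "\<dots> \<le> ennreal (2 powr p) * (ennreal C1 * Q * ennreal ((1 - norm z) powr \<alpha>)
           + ennreal (?Y z powr p * (1 - norm z) powr \<alpha>))"
        by (intro mult_left_mono add_right_mono mult_right_mono X_le) auto
      finally show ?thesis using True by (simp add: XY)
    qed simp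
    have "(\<integral>\<^sup>+z. indicator unit_ball z * ennreal (integral {0..1} (\<lambda>t. u (t *\<^sub>R z)) powr p * (1 - norm z) powr \<alpha>) \<partial>lborel)
       \<le> (\<integral>\<^sup>+z. ennreal (2 powr p) * (ennreal C1 * Q * (indicator unit_ball z * ennreal ((1 - norm z) powr \<alpha>))
         + indicator unit_ball z * ennreal (?Y z powr p * (1 - norm z) powr \<alpha>)) \<partial>lborel)"
      by (rule nn_integral_mono[OF ptw])
    also have "\<dots> = ennreal (2 powr p) * (\<integral>\<^sup>+z. ennreal C1 * Q * (indicator unit_ball z * ennreal ((1 - norm z) powr \<alpha>))
         + indicator unit_ball z * ennreal (?Y z powr p * (1 - norm z) powr \<alpha>) \<partial>lborel)"
      by (rule nn_integral_cmult) measurable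
    also have "\<dots> = ennreal (2 powr p) * (ennreal C1 * Q * ennreal W
         + (\<integral>\<^sup>+z. indicator unit_ball z * ennreal (?Y z powr p * (1 - norm z) powr \<alpha>) \<partial>lborel))"
      by (subst nn_integral_add) (measurable, simp add: nn_integral_cmult W(1))
    also have "\<dots> \<le> ennreal (2 powr p) * (ennreal C1 * Q * ennreal W + ennreal C3 * (ennreal C2 * Q))"
    proof (intro mult_left_mono add_left_mono)
      have "(\<integral>\<^sup>+z. indicator unit_ball z * ennreal (?Y z powr p * (1 - norm z) powr \<alpha>) \<partial>lborel)
          \<le> ennreal C3 * bergman_pow (\<alpha> + p) p (partial_deriv h j)"
        unfolding bergman_pow_def using hardy[OF u] by (simp add: u_def)
      also have "\<dots> \<le> ennreal C3 * (ennreal C2 * Q)"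
        unfolding Q_def by (intro mult_left_mono cauchy[OF h]) auto
      finally show "(\<integral>\<^sup>+z. indicator unit_ball z * ennreal (?Y z powr p * (1 - norm z) powr \<alpha>) \<partial>lborel)
          \<le> ennreal C3 * (ennreal C2 * Q)" .
    qed auto
    also have "\<dots> = ennreal C * Q"
      unfolding C_def using C1 C2 C3 W(2)
      by (simp add: ennreal_mult ennreal_plus algebra_simps)
    finally show ?thesis unfolding u_def Q_def .
  qed
  moreover have "0 < C" using C1 C2 C3 W(2) by (simp add: C_def add_nonneg_pos)
  ultimately show ?thesis by blast
qed

section \<open>The Riemann-Stieltjes operator\<close>

lemma partial_deriv_cmult:
  fixes f :: "complex ^ 'n \<Rightarrow> complex"
  assumes "open S" "mv_holomorphic_on f S" "z \<in> S"
  shows "partial_deriv (\<lambda>z. c * f z) j z = c * partial_deriv f j z"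
proof -
  have "((\<lambda>z. c * f z) has_derivative (\<lambda>v. c * (\<Sum>j\<in>UNIV. v $ j * partial_deriv f j z))) (at z)"
    by (intro has_derivative_mult_right mv_holomorphic_has_derivative[OF assms])
  moreover have "c * (\<Sum>j\<in>UNIV. (a *s v) $ j * partial_deriv f j z) = a * (c * (\<Sum>j\<in>UNIV. v $ j * partial_deriv f j z))" for a v
    by (simp add: sum_distrib_left mult_ac)
  ultimately show ?thesis using partial_deriv_eqI[of "\<lambda>z. c * f z" _ z j] by (simp add: sum_axis)
qed

lemma partial_deriv_component: "partial_deriv (\<lambda>z. z $ i) j z = axis j 1 $ i"
  by (rule partial_deriv_eqI[where D="\<lambda>v. v $ i"])
     (auto intro: bounded_linear.has_derivative[OF bounded_linear_vec_nth has_derivative_ident])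

lemma norm_radial_deriv_le:
  fixes f :: "complex ^ 'n \<Rightarrow> complex"
  assumes "norm z \<le> 1"
  shows "norm (radial_deriv f z) \<le> norm (complex_gradient f z)"
proof -
  have "norm (radial_deriv f z) \<le> (\<Sum>j\<in>UNIV. \<bar>norm (z $ j)\<bar> * \<bar>norm (complex_gradient f z $ j)\<bar>)"
    unfolding radial_deriv_def complex_gradient_def by (rule order_trans[OF norm_sum]) (simp add: norm_mult)
  also have "\<dots> \<le> norm z * norm (complex_gradient f z)"
    unfolding norm_vec_def by (rule L2_set_mult_ineq)
  also have "\<dots> \<le> 1 * norm (complex_gradient f z)" using assms by (intro mult_right_mono) auto
  finally show ?thesis by simp
qed

lemma norm_complex_gradient_le: "norm (complex_gradient f z) \<le> (\<Sum>j\<in>UNIV. norm (partial_deriv f j z))"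
  unfolding norm_vec_def complex_gradient_def
  by (rule order_trans[OF L2_set_le_sum]) auto

lemma continuous_on_complex_gradient:
  "open S \<Longrightarrow> mv_holomorphic_on f S \<Longrightarrow> continuous_on S (complex_gradient f)"
  unfolding complex_gradient_def[abs_def] by (intro continuous_on_vec_lambda continuous_on_partial_deriv)

lemma mv_holomorphic_radial_deriv:
  "open S \<Longrightarrow> mv_holomorphic_on f S \<Longrightarrow> mv_holomorphic_on (radial_deriv f) S"
  unfolding radial_deriv_def[abs_def]
  by (intro mv_holomorphic_sum mv_holomorphic_mult mv_holomorphic_component mv_holomorphic_partial_deriv)

text \<open>
  The facts about the operator on which both directions rest. With \<open>h = \<phi> R f\<close>, the integrand
  \<open>h(tz) / t\<close> extends to the jointly continuous function \<open>\<Psi>\<close>, since \<open>R f (tz)\<close> has the factor \<open>t\<close>. So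
  one may differentiate under the integral sign, where the factor \<open>1 / t\<close> is cancelled by the chain
  rule. Summing the result against \<open>z $ j\<close> gives the integral of the derivative of \<open>h(tz)\<close> in \<open>t\<close>,
  hence \<open>h(z) - h(0) = h(z)\<close>.
\<close>

lemma
  fixes \<phi> f :: "complex ^ 'n \<Rightarrow> complex"
  assumes \<phi>: "mv_holomorphic_on \<phi> unit_ball" and f: "mv_holomorphic_on f unit_ball"
  defines "h \<equiv> \<lambda>z. \<phi> z * radial_deriv f z"
  shows mv_holomorphic_riemann_stieltjes: "mv_holomorphic_on (riemann_stieltjes \<phi> f) unit_ball"
    and partial_deriv_riemann_stieltjes: "z \<in> unit_ball \<Longrightarrow>
      partial_deriv (riemann_stieltjes \<phi> f) j z = integral {0..1} (\<lambda>t. partial_deriv h j (t *\<^sub>R z))"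
    and radial_deriv_riemann_stieltjes: "z \<in> unit_ball \<Longrightarrow> radial_deriv (riemann_stieltjes \<phi> f) z = h z"
proof -
  have h: "mv_holomorphic_on h unit_ball"
    unfolding h_def by (intro mv_holomorphic_mult \<phi> mv_holomorphic_radial_deriv f) auto
  \<comment> \<open>the summand \<open>0\<close> gives the argument the shape \<open>a + t *\<^sub>R z\<close> of the affine substitutions above\<close>
  define \<Psi> where "\<Psi> = (\<lambda>(z :: complex ^ 'n) (t :: real). \<Sum>j\<in>UNIV. z $ j * (\<phi> (0 + t *\<^sub>R z) * partial_deriv f j (0 + t *\<^sub>R z)))"
  have \<Psi>: "h (t *\<^sub>R z) = of_real t * \<Psi> z t" for z t
    by (simp add: h_def \<Psi>_def radial_deriv_def sum_distrib_left scaleR_conv_of_real[where 'a=complex] mult_ac)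
  have U_eq: "riemann_stieltjes \<phi> f z = integral {0..1} (\<Psi> z)" for z
    unfolding riemann_stieltjes_def
    by (rule integral_spike[of "{0}"]) (use \<Psi>[unfolded h_def] in auto)
  have in_ball: "0 + t *\<^sub>R z \<in> unit_ball" if "z \<in> unit_ball" "t \<in> {0..1}" for t and z :: "complex ^ 'n"
    using that mult_left_le_one_le[of "norm z" "\<bar>t\<bar>"] by auto
  have \<Psi>_cont: "continuous_on (unit_ball \<times> {0..1}) (\<lambda>(z, t). \<Psi> z t)"
  proof -
    have "continuous_on (unit_ball \<times> {0..1}) (\<lambda>y. g (0 + snd y *\<^sub>R fst y))"
      if "continuous_on unit_ball g" for g :: "complex ^ 'n \<Rightarrow> complex"
      by (rule continuous_on_compose2[OF that]) (use in_ball in \<open>auto intro!: continuous_intros\<close>)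
    note this[OF mv_holomorphic_imp_continuous_on[OF \<phi>]] this[OF continuous_on_partial_deriv[OF _ f]]
    then show ?thesis unfolding \<Psi>_def split_beta by (intro continuous_intros) auto
  qed
  have \<Psi>_hol: "mv_holomorphic_on (\<lambda>z. \<Psi> z t) unit_ball" if "t \<in> {0..1}" for t
    unfolding \<Psi>_def
    by (intro mv_holomorphic_sum mv_holomorphic_mult mv_holomorphic_component
        mv_holomorphic_compose_affine(1)[OF \<phi>] mv_holomorphic_compose_affine(1)[OF mv_holomorphic_partial_deriv[OF _ f]])
       (use in_ball that in auto)
  have U_fun: "riemann_stieltjes \<phi> f = (\<lambda>z. integral {0..1} (\<Psi> z))" using U_eq by blast
  show "mv_holomorphic_on (riemann_stieltjes \<phi> f) unit_ball"
    unfolding U_fun by (rule mv_holomorphic_integral_param[OF _ _ \<Psi>_cont \<Psi>_hol]) auto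
  have pd: "partial_deriv (riemann_stieltjes \<phi> f) j z = integral {0..1} (\<lambda>t. partial_deriv h j (t *\<^sub>R z))"
    if z: "z \<in> unit_ball" for z j
  proof -
    have "partial_deriv (riemann_stieltjes \<phi> f) j z = integral {0..1} (\<lambda>t. partial_deriv (\<lambda>z. \<Psi> z t) j z)"
      unfolding U_fun by (rule partial_deriv_integral_param[OF _ _ \<Psi>_cont \<Psi>_hol z]) auto
    also have "\<dots> = integral {0..1} (\<lambda>t. partial_deriv h j (t *\<^sub>R z))"
    proof (rule integral_spike[of "{0}"])
      fix t :: real assume t: "t \<in> {0..1} - {0}"
      have "of_real t * partial_deriv h j (0 + t *\<^sub>R z) = partial_deriv (\<lambda>z. h (0 + t *\<^sub>R z)) j z"
        using mv_holomorphic_compose_affine(2)[OF h in_ball _ z, of t j] t by simp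
      also have "\<dots> = partial_deriv (\<lambda>z. of_real t * \<Psi> z t) j z" by (simp add: \<Psi>)
      also have "\<dots> = of_real t * partial_deriv (\<lambda>z. \<Psi> z t) j z"
        by (rule partial_deriv_cmult[OF _ \<Psi>_hol z]) (use t in auto)
      finally show "partial_deriv h j (t *\<^sub>R z) = partial_deriv (\<lambda>z. \<Psi> z t) j z"
        using t by simp
    qed simp
    finally show ?thesis .
  qed
  then show "z \<in> unit_ball \<Longrightarrow>
      partial_deriv (riemann_stieltjes \<phi> f) j z = integral {0..1} (\<lambda>t. partial_deriv h j (t *\<^sub>R z))" .
  show "radial_deriv (riemann_stieltjes \<phi> f) z = h z" if z: "z \<in> unit_ball"
  proof -
    have cont: "continuous_on {0..1} (\<lambda>t. partial_deriv h j (t *\<^sub>R z))" for j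
      by (rule continuous_on_radial_integral(2)[OF continuous_on_partial_deriv[OF _ h]]) (use z in auto)
    have "((\<lambda>t. \<Sum>j\<in>UNIV. z $ j * partial_deriv h j (t *\<^sub>R z)) has_integral (h (1 *\<^sub>R z) - h (0 *\<^sub>R z))) {0..1}"
    proof (rule fundamental_theorem_of_calculus)
      fix t :: real assume t: "t \<in> {0..1}"
      have "((\<lambda>t. t *\<^sub>R z) has_derivative (\<lambda>s. s *\<^sub>R z)) (at t)" by (auto intro!: derivative_eq_intros)
      from diff_chain_at[OF this mv_holomorphic_has_derivative[OF _ h]] in_ball[OF z t]
      have "((\<lambda>t. h (t *\<^sub>R z)) has_derivative (\<lambda>s. \<Sum>j\<in>UNIV. (s *\<^sub>R z) $ j * partial_deriv h j (t *\<^sub>R z))) (at t)"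
        by (simp add: o_def)
      then have "((\<lambda>t. h (t *\<^sub>R z)) has_vector_derivative (\<Sum>j\<in>UNIV. z $ j * partial_deriv h j (t *\<^sub>R z))) (at t)"
        unfolding has_vector_derivative_def by (rule has_derivative_eq_rhs) (simp add: fun_eq_iff scaleR_right.sum)
      then show "((\<lambda>t. h (t *\<^sub>R z)) has_vector_derivative (\<Sum>j\<in>UNIV. z $ j * partial_deriv h j (t *\<^sub>R z))) (at t within {0..1})"
        by (rule has_vector_derivative_at_within)
    qed simp
    moreover have "h 0 = 0" by (simp add: h_def radial_deriv_def)
    ultimately have "h z = integral {0..1} (\<lambda>t. \<Sum>j\<in>UNIV. z $ j * partial_deriv h j (t *\<^sub>R z))"
      by (simp add: integral_unique)
    also have "\<dots> = (\<Sum>j\<in>UNIV. integral {0..1} (\<lambda>t. z $ j * partial_deriv h j (t *\<^sub>R z)))"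
      by (rule integral_sum) (auto intro!: integrable_continuous_real continuous_intros cont)
    also have "\<dots> = radial_deriv (riemann_stieltjes \<phi> f) z"
      by (simp add: radial_deriv_def pd[OF z])
    finally show ?thesis by simp
  qed
qed

lemma riemann_stieltjes_0 [simp]: "riemann_stieltjes \<phi> f 0 = 0"
  by (simp add: riemann_stieltjes_def radial_deriv_def)

section \<open>Bounded symbols give bounded operators\<close>

text \<open>
  The integral in the \<open>p\<close>-th power of the Besov-Sobolev norm, with all powers of \<open>1 - (norm z)\<^sup>2\<close> collected into
  one exponent \<open>\<alpha>\<close>, and with Lebesgue measure in place of the normalized volume.
\<close>

definition gradient_energy :: "real \<Rightarrow> real \<Rightarrow> (complex ^ 'n \<Rightarrow> complex) \<Rightarrow> ennreal" where
  "gradient_energy \<alpha> p f =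
    (\<integral>\<^sup>+z. indicator unit_ball z * ennreal (norm (complex_gradient f z) powr p * (1 - (norm z)\<^sup>2) powr \<alpha>) \<partial>lborel)"

lemma norm_square_less_1: "norm (z::'a::real_normed_vector) < 1 \<Longrightarrow> (norm z)\<^sup>2 < 1"
  by (simp add: power_less_one_iff abs_square_less_1)

lemma continuous_on_weight:
  "continuous_on (ball 0 1) (\<lambda>z::'a::real_normed_vector. (1 - (norm z)\<^sup>2) powr s)"
proof (intro continuous_on_powr continuous_intros ballI)
  fix z :: 'a assume "z \<in> ball 0 1"
  then have "(norm z)\<^sup>2 < 1" by (simp add: norm_square_less_1)
  then show "1 - (norm z)\<^sup>2 \<noteq> 0" by linarith
qed

lemma weight_comparable:
  fixes z :: "'a::real_normed_vector" and \<alpha> :: real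
  assumes "norm z < 1"
  shows "(1 - norm z) powr \<alpha> \<le> 2 powr \<bar>\<alpha>\<bar> * (1 - (norm z)\<^sup>2) powr \<alpha>"
    and "(1 - (norm z)\<^sup>2) powr \<alpha> \<le> 2 powr \<bar>\<alpha>\<bar> * (1 - norm z) powr \<alpha>"
proof -
  have *: "0 < 1 - norm z" "0 < 1 - (norm z)\<^sup>2" using assms norm_square_less_1[OF assms] by auto
  have eq: "1 - (norm z)\<^sup>2 = (1 - norm z) * (1 + norm z)" by (simp add: power2_eq_square algebra_simps)
  have 1: "1 - (norm z)\<^sup>2 \<le> 2 * (1 - norm z)"
    using mult_left_mono[of "1 + norm z" 2 "1 - norm z"] assms unfolding eq by simp
  have 2: "1 - norm z \<le> 1 - (norm z)\<^sup>2"
    using mult_left_mono[of 1 "1 + norm z" "1 - norm z"] assms unfolding eq by simp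
  have 3: "1 - norm z \<le> 2 * (1 - (norm z)\<^sup>2)" using 2 * by argo
  show "(1 - norm z) powr \<alpha> \<le> 2 powr \<bar>\<alpha>\<bar> * (1 - (norm z)\<^sup>2) powr \<alpha>"
    by (rule powr_le_of_comparable[OF * 3 1])
  show "(1 - (norm z)\<^sup>2) powr \<alpha> \<le> 2 powr \<bar>\<alpha>\<bar> * (1 - norm z) powr \<alpha>"
    by (rule powr_le_of_comparable[OF *(2,1) 1 3])
qed

lemma gradient_energy_integrand_measurable:
  fixes f :: "complex ^ 'n \<Rightarrow> complex"
  assumes f: "mv_holomorphic_on f unit_ball" and p: "1 < p"
  shows "(\<lambda>z. indicator unit_ball z * ennreal (norm (complex_gradient f z) powr p * (1 - (norm z)\<^sup>2) powr \<alpha>))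
    \<in> borel_measurable borel"
  using p by (intro borel_measurable_indicator_mult_ennreal continuous_on_mult continuous_on_powr' continuous_on_norm
    continuous_on_weight continuous_on_complex_gradient f) auto

text \<open>
  The integrand need not be measurable off the ball, so it has to be replaced by its restriction
  to the ball before the densities can be evaluated.
\<close>

lemma besov_pow_eq:
  fixes f :: "complex ^ 'n \<Rightarrow> complex"
  assumes f: "mv_holomorphic_on f unit_ball" and p: "1 < p"
  shows "besov_pow p \<sigma> f = ennreal (norm (f 0) powr p) +
    gradient_energy ((1 + \<sigma>) * p - real CARD('n) - 1) p f / emeasure lborel (unit_ball :: (complex ^ 'n) set)"
proof -
  let ?B = "unit_ball :: (complex ^ 'n) set"
  define \<alpha> where "\<alpha> = (1 + \<sigma>) * p - real CARD('n) - 1"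
  define w where "w = (\<lambda>z :: complex ^ 'n. ennreal ((1 - (norm z)\<^sup>2) powr (- real CARD('n) - 1)))"
  define F where "F = (\<lambda>z. ennreal (norm ((1 - (norm z)\<^sup>2) powr (1 + \<sigma>) *\<^sub>R complex_gradient f z) powr p))"
  define G where "G = (\<lambda>z. indicator ?B z * F z)"
  have [measurable]: "?B \<in> sets borel" by simp
  have [measurable]: "w \<in> borel_measurable borel" unfolding w_def by measurable
  have grad: "continuous_on unit_ball (complex_gradient f)"
    using f by (intro continuous_on_complex_gradient) auto
  have [measurable]: "G \<in> borel_measurable borel"
    unfolding G_def F_def using p
    by (intro borel_measurable_indicator_mult_ennreal continuous_on_powr' continuous_on_norm
        continuous_on_scaleR continuous_on_weight grad) auto
  have "(\<integral>\<^sup>+z. F z \<partial>invariant_measure) = (\<integral>\<^sup>+z. G z \<partial>invariant_measure)"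
  proof (rule nn_integral_cong_AE)
    have "AE z in ball_volume. F z = G z"
      unfolding ball_volume_def by (rule AE_uniform_measureI) (auto simp: G_def)
    then show "AE z in invariant_measure. F z = G z"
      unfolding invariant_measure_def w_def[symmetric]
      by (subst AE_density) (auto simp: ball_volume_def)
  qed
  also have "\<dots> = (\<integral>\<^sup>+z. w z * G z \<partial>ball_volume)"
    unfolding invariant_measure_def w_def[symmetric]
    by (rule nn_integral_density) (auto simp: ball_volume_def)
  also have "\<dots> = (\<integral>\<^sup>+z. w z * G z * indicator ?B z \<partial>lborel) / emeasure lborel ?B"
    unfolding ball_volume_def by (rule nn_integral_uniform_measure) auto
  also have "(\<integral>\<^sup>+z. w z * G z * indicator ?B z \<partial>lborel) = gradient_energy \<alpha> p f"
    unfolding gradient_energy_def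
  proof (rule nn_integral_cong)
    fix z :: "complex ^ 'n"
    show "w z * G z * indicator ?B z =
        indicator ?B z * ennreal (norm (complex_gradient f z) powr p * (1 - (norm z)\<^sup>2) powr \<alpha>)"
    proof (cases "norm z < 1")
      case True
      define x where "x = 1 - (norm z)\<^sup>2"
      have "0 < x" using norm_square_less_1[OF True] by (simp add: x_def)
      have "x powr (- real CARD('n) - 1) * (x powr (1 + \<sigma>) * norm (complex_gradient f z)) powr p
          = norm (complex_gradient f z) powr p * (x powr (- real CARD('n) - 1) * x powr ((1 + \<sigma>) * p))"
        by (simp add: powr_mult powr_powr)
      also have "x powr (- real CARD('n) - 1) * x powr ((1 + \<sigma>) * p) = x powr \<alpha>"
        unfolding powr_add[symmetric] by (simp add: \<alpha>_def algebra_simps)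
      finally show ?thesis
        using True by (simp add: G_def F_def w_def x_def[symmetric] ennreal_mult[symmetric])
    qed simp
  qed
  finally show ?thesis unfolding besov_pow_def F_def \<alpha>_def by simp
qed

lemma sum_powr_le:
  fixes x :: "'i \<Rightarrow> real"
  assumes "finite I" "\<And>i. i \<in> I \<Longrightarrow> 0 \<le> x i" "1 < p"
  shows "(\<Sum>i\<in>I. x i) powr p \<le> real (card I) powr p * (\<Sum>i\<in>I. x i powr p)"
proof -
  define m where "m = (\<Sum>i\<in>I. x i powr p) powr (1 / p)"
  have "x i \<le> m" if "i \<in> I" for i
  proof -
    have "x i powr p \<le> (\<Sum>i\<in>I. x i powr p)" using assms that by (intro member_le_sum) auto
    then have "(x i powr p) powr (1 / p) \<le> m" unfolding m_def using assms by (intro powr_mono2) auto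
    then show ?thesis using assms that by (simp add: powr_powr)
  qed
  then have "(\<Sum>i\<in>I. x i) \<le> real (card I) * m" by (rule sum_bounded_above)
  then have "(\<Sum>i\<in>I. x i) powr p \<le> (real (card I) * m) powr p"
    using assms by (intro powr_mono2 sum_nonneg) auto
  also have "\<dots> = real (card I) powr p * (\<Sum>i\<in>I. x i powr p)"
    using assms by (simp add: m_def powr_mult powr_powr sum_nonneg)
  finally show ?thesis .
qed

text \<open>
  Each partial derivative of the image of \<open>f\<close> is a radial integral of a derivative of
  \<open>h = \<phi> R f\<close>, so the core estimate bounds the energy by \<open>bergman_pow \<alpha> p h\<close>, and
  \<open>norm (h z) \<le> M * norm (complex_gradient f z)\<close>.
\<close>

lemma gradient_energy_riemann_stieltjes_le:
  fixes \<phi> :: "complex ^ 'n \<Rightarrow> complex" and p \<alpha> M :: real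
  assumes \<phi>: "mv_holomorphic_on \<phi> unit_ball" and p: "1 < p" and \<alpha>: "-1 < \<alpha>"
    and M: "\<And>z. z \<in> unit_ball \<Longrightarrow> norm (\<phi> z) \<le> M"
  shows "\<exists>C\<ge>0. \<forall>f. mv_holomorphic_on f unit_ball \<longrightarrow>
    gradient_energy \<alpha> p (riemann_stieltjes \<phi> f) \<le> ennreal C * gradient_energy \<alpha> p f"
proof -
  obtain C where C: "0 < C" and le: "\<And>(h :: complex ^ 'n \<Rightarrow> complex) j. mv_holomorphic_on h unit_ball \<Longrightarrow>
    (\<integral>\<^sup>+z. indicator unit_ball z *
       ennreal (integral {0..1} (\<lambda>t. norm (partial_deriv h j (t *\<^sub>R z))) powr p * (1 - norm z) powr \<alpha>) \<partial>lborel)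
    \<le> ennreal C * bergman_pow \<alpha> p h"
    using radial_integral_partial_deriv_le[OF p \<alpha>, where 'n='n] by blast
  let ?n = "real CARD('n)"
  define A where "A = ?n powr p * 2 powr \<bar>\<alpha>\<bar>"
  have M0: "0 \<le> M" using order_trans[OF norm_ge_zero M[of 0]] by simp
  have [measurable]: "unit_ball \<in> sets (borel :: (complex ^ 'n) measure)" by simp
  have "gradient_energy \<alpha> p (riemann_stieltjes \<phi> f)
      \<le> ennreal (A * (?n * (C * (M powr p * 2 powr \<bar>\<alpha>\<bar>)))) * gradient_energy \<alpha> p f"
    if f: "mv_holomorphic_on f unit_ball" for f
  proof -
    define h where "h = (\<lambda>z. \<phi> z * radial_deriv f z)"
    have h: "mv_holomorphic_on h unit_ball"
      unfolding h_def by (intro mv_holomorphic_mult \<phi> mv_holomorphic_radial_deriv f) auto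
    define H where "H = (\<lambda>j z. integral {0..1} (\<lambda>t. norm (partial_deriv h j (t *\<^sub>R z))))"
    have dcont: "continuous_on unit_ball (\<lambda>w. norm (partial_deriv h j w))" for j
      using continuous_on_partial_deriv[OF _ h] by (auto intro!: continuous_intros)
    have tcont: "continuous_on {0..1} (\<lambda>t. partial_deriv h j (t *\<^sub>R z))" if "z \<in> unit_ball" for j z
      by (rule continuous_on_radial_integral(2)[OF continuous_on_partial_deriv[OF _ h]]) (use that in auto)
    have H0: "0 \<le> H j z" if "z \<in> unit_ball" for j z
      unfolding H_def by (intro integral_nonneg integrable_continuous_real continuous_intros tcont that) auto
    have Hcont: "continuous_on unit_ball (H j)" for j
      unfolding H_def by (rule continuous_on_radial_integral(1)[OF dcont]) auto
    have H_meas: "(\<lambda>z. indicator unit_ball z * ennreal (H j z powr p * (1 - norm z) powr \<alpha>)) \<in> borel_measurable lborel" for j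
      unfolding measurable_lborel2
      using Hcont H0 p by (intro borel_measurable_indicator_mult_ennreal) (auto intro!: continuous_intros continuous_on_powr')
    have grad_le: "norm (complex_gradient (riemann_stieltjes \<phi> f) z) \<le> (\<Sum>j\<in>UNIV. H j z)" if z: "z \<in> unit_ball" for z
    proof (rule order_trans[OF norm_complex_gradient_le sum_mono])
      fix j
      show "norm (partial_deriv (riemann_stieltjes \<phi> f) j z) \<le> H j z"
        unfolding partial_deriv_riemann_stieltjes[OF \<phi> f z] H_def h_def[symmetric]
        by (intro integral_norm_bound_integral integrable_continuous_real continuous_intros tcont z) auto
    qed
    have "gradient_energy \<alpha> p (riemann_stieltjes \<phi> f)
      \<le> (\<integral>\<^sup>+z. ennreal A * (\<Sum>j\<in>UNIV. indicator unit_ball z * ennreal (H j z powr p * (1 - norm z) powr \<alpha>)) \<partial>lborel)"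
      unfolding gradient_energy_def
    proof (rule nn_integral_mono)
      fix z :: "complex ^ 'n"
      show "indicator unit_ball z * ennreal (norm (complex_gradient (riemann_stieltjes \<phi> f) z) powr p * (1 - (norm z)\<^sup>2) powr \<alpha>)
        \<le> ennreal A * (\<Sum>j\<in>UNIV. indicator unit_ball z * ennreal (H j z powr p * (1 - norm z) powr \<alpha>))"
      proof (cases "z \<in> unit_ball")
        case True
        have "norm (complex_gradient (riemann_stieltjes \<phi> f) z) powr p \<le> (\<Sum>j\<in>UNIV. H j z) powr p"
          using grad_le[OF True] p by (intro powr_mono2) auto
        also have "\<dots> \<le> ?n powr p * (\<Sum>j\<in>UNIV. H j z powr p)"
          by (rule sum_powr_le) (use H0[OF True] p in auto)
        finally have "norm (complex_gradient (riemann_stieltjes \<phi> f) z) powr p * (1 - (norm z)\<^sup>2) powr \<alpha>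
          \<le> (?n powr p * (\<Sum>j\<in>UNIV. H j z powr p)) * (2 powr \<bar>\<alpha>\<bar> * (1 - norm z) powr \<alpha>)"
          using True by (intro mult_mono weight_comparable) (auto intro!: mult_nonneg_nonneg sum_nonneg)
        also have "\<dots> = A * (\<Sum>j\<in>UNIV. H j z powr p * (1 - norm z) powr \<alpha>)"
          by (simp add: A_def sum_distrib_left sum_distrib_right mult_ac)
        finally have "ennreal (norm (complex_gradient (riemann_stieltjes \<phi> f) z) powr p * (1 - (norm z)\<^sup>2) powr \<alpha>)
          \<le> ennreal (A * (\<Sum>j\<in>UNIV. H j z powr p * (1 - norm z) powr \<alpha>))" by (rule ennreal_leI)
        also have "\<dots> = ennreal A * (\<Sum>j\<in>UNIV. ennreal (H j z powr p * (1 - norm z) powr \<alpha>))"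
          by (subst ennreal_mult) (auto simp: A_def sum_nonneg sum_ennreal)
        finally show ?thesis using True by simp
      qed simp
    qed
    also have "\<dots> = ennreal A * (\<Sum>j\<in>UNIV. \<integral>\<^sup>+z. indicator unit_ball z * ennreal (H j z powr p * (1 - norm z) powr \<alpha>) \<partial>lborel)"
      unfolding nn_integral_sum[OF H_meas, symmetric]
      by (rule nn_integral_cmult) (intro borel_measurable_sum H_meas)
    also have "\<dots> \<le> ennreal A * (\<Sum>j\<in>(UNIV::'n set). ennreal C * bergman_pow \<alpha> p h)"
      unfolding H_def by (intro mult_left_mono sum_mono le h) auto
    also have "\<dots> = ennreal A * (ennreal ?n * (ennreal C * bergman_pow \<alpha> p h))"
      by (simp add: ennreal_of_nat_eq_real_of_nat)
    also have "\<dots> \<le> ennreal A * (ennreal ?n * (ennreal C * (ennreal (M powr p * 2 powr \<bar>\<alpha>\<bar>) * gradient_energy \<alpha> p f)))"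
    proof (intro mult_left_mono)
      have "bergman_pow \<alpha> p h \<le> (\<integral>\<^sup>+z. ennreal (M powr p * 2 powr \<bar>\<alpha>\<bar>) * (indicator unit_ball z *
          ennreal (norm (complex_gradient f z) powr p * (1 - (norm z)\<^sup>2) powr \<alpha>)) \<partial>lborel)"
        unfolding bergman_pow_def
      proof (rule nn_integral_mono)
        fix z :: "complex ^ 'n"
        show "indicator unit_ball z * ennreal (norm (h z) powr p * (1 - norm z) powr \<alpha>) \<le> ennreal (M powr p * 2 powr \<bar>\<alpha>\<bar>) *
          (indicator unit_ball z * ennreal (norm (complex_gradient f z) powr p * (1 - (norm z)\<^sup>2) powr \<alpha>))"
        proof (cases "z \<in> unit_ball")
          case True
          have "norm (h z) \<le> M * norm (complex_gradient f z)"
            unfolding h_def norm_mult using True M0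
            by (intro mult_mono M norm_radial_deriv_le) auto
          then have "norm (h z) powr p \<le> (M * norm (complex_gradient f z)) powr p"
            using p by (intro powr_mono2) auto
          then have "norm (h z) powr p * (1 - norm z) powr \<alpha> \<le>
              (M * norm (complex_gradient f z)) powr p * (2 powr \<bar>\<alpha>\<bar> * (1 - (norm z)\<^sup>2) powr \<alpha>)"
            using True by (intro mult_mono weight_comparable) auto
          also have "\<dots> = (M powr p * 2 powr \<bar>\<alpha>\<bar>) * (norm (complex_gradient f z) powr p * (1 - (norm z)\<^sup>2) powr \<alpha>)"
            using M0 by (simp add: powr_mult mult_ac)
          finally show ?thesis using True
            by (simp add: ennreal_mult[symmetric] ennreal_leI del: ennreal_mult)
        qed simp
      qed
      also have "\<dots> = ennreal (M powr p * 2 powr \<bar>\<alpha>\<bar>) * gradient_energy \<alpha> p f"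
        unfolding gradient_energy_def
        using gradient_energy_integrand_measurable[OF f p] by (intro nn_integral_cmult) simp
      finally show "bergman_pow \<alpha> p h \<le> ennreal (M powr p * 2 powr \<bar>\<alpha>\<bar>) * gradient_energy \<alpha> p f" .
    qed auto
    also have "\<dots> = ennreal (A * (?n * (C * (M powr p * 2 powr \<bar>\<alpha>\<bar>)))) * gradient_energy \<alpha> p f"
      using C by (simp add: ennreal_mult A_def mult.assoc)
    finally show ?thesis .
  qed
  moreover have "0 \<le> A * (?n * (C * (M powr p * 2 powr \<bar>\<alpha>\<bar>)))" using C by (simp add: A_def)
  ultimately show ?thesis by blast
qed

lemma Hinf_norm_finite_imp_besov_bounded:
  fixes \<phi> :: "complex ^ 'n \<Rightarrow> complex" and p \<sigma> :: real
  assumes \<phi>: "mv_holomorphic_on \<phi> unit_ball" and p: "1 < p" and \<sigma>: "1 + \<sigma> > real CARD('n) / p"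
    and fin: "Hinf_norm \<phi> < \<infinity>"
  shows "besov_bounded p \<sigma> (riemann_stieltjes \<phi>)"
proof -
  define \<alpha> where "\<alpha> = (1 + \<sigma>) * p - real CARD('n) - 1"
  have \<alpha>: "-1 < \<alpha>" using \<sigma> p by (simp add: \<alpha>_def field_simps)
  obtain M where M: "Hinf_norm \<phi> = ennreal M" "0 \<le> M" using fin by (cases "Hinf_norm \<phi>") auto
  have "norm (\<phi> z) \<le> M" if "z \<in> unit_ball" for z
  proof -
    have "ennreal (norm (\<phi> z)) \<le> Hinf_norm \<phi>" unfolding Hinf_norm_def by (rule SUP_upper[OF that])
    then show ?thesis using M by simp
  qed
  from gradient_energy_riemann_stieltjes_le[OF \<phi> p \<alpha> this]
  obtain C where C: "0 \<le> C" and le: "\<And>f. mv_holomorphic_on f unit_ball \<Longrightarrow>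
    gradient_energy \<alpha> p (riemann_stieltjes \<phi> f) \<le> ennreal C * gradient_energy \<alpha> p f" by blast
  have pow_le: "besov_pow p \<sigma> (riemann_stieltjes \<phi> f) \<le> ennreal C * besov_pow p \<sigma> f"
    if f: "mv_holomorphic_on f unit_ball" for f
  proof -
    let ?V = "emeasure lborel (unit_ball :: (complex ^ 'n) set)"
    have "besov_pow p \<sigma> (riemann_stieltjes \<phi> f) = gradient_energy \<alpha> p (riemann_stieltjes \<phi> f) / ?V"
      unfolding besov_pow_eq[OF mv_holomorphic_riemann_stieltjes[OF \<phi> f] p] \<alpha>_def using p by simp
    also have "\<dots> \<le> ennreal C * gradient_energy \<alpha> p f / ?V"
      by (rule divide_right_mono_ennreal[OF le[OF f]])
    also have "\<dots> = ennreal C * (gradient_energy \<alpha> p f / ?V)"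
      by (rule ennreal_times_divide[symmetric])
    also have "\<dots> \<le> ennreal C * besov_pow p \<sigma> f"
      unfolding besov_pow_eq[OF f p] \<alpha>_def by (intro mult_left_mono) auto
    finally show ?thesis .
  qed
  show ?thesis
    unfolding besov_bounded_def
  proof (intro conjI ballI exI[where x="C powr (1 / p)"])
    fix f :: "complex ^ 'n \<Rightarrow> complex" assume "f \<in> besov_space p \<sigma>"
    then have f: "mv_holomorphic_on f unit_ball" and fin: "besov_pow p \<sigma> f < \<infinity>"
      by (auto simp: besov_space_def)
    have rfin: "ennreal C * besov_pow p \<sigma> f < \<infinity>" using fin by (simp add: ennreal_mult_less_top)
    then show "riemann_stieltjes \<phi> f \<in> besov_space p \<sigma>"
      using pow_le[OF f] mv_holomorphic_riemann_stieltjes[OF \<phi> f] by (auto simp: besov_space_def)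
    have "enn2real (besov_pow p \<sigma> (riemann_stieltjes \<phi> f)) \<le> C * enn2real (besov_pow p \<sigma> f)"
      using enn2real_mono[OF pow_le[OF f]] rfin C by (simp add: enn2real_mult)
    then have "enn2real (besov_pow p \<sigma> (riemann_stieltjes \<phi> f)) powr (1 / p) \<le> (C * enn2real (besov_pow p \<sigma> f)) powr (1 / p)"
      using p by (intro powr_mono2) auto
    then show "besov_norm p \<sigma> (riemann_stieltjes \<phi> f) \<le> C powr (1 / p) * besov_norm p \<sigma> f"
      using C by (simp add: besov_norm_def powr_mult)
  qed
qed

section \<open>Bounded operators have bounded symbols\<close>

lemma powr_of_power: "0 \<le> x \<Longrightarrow> (x ^ k) powr p = (x powr p) ^ k" for x p :: real
  by (induction k) (simp_all add: powr_mult)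

text \<open>
  The iterates \<open>F k\<close> of the operator on a coordinate function satisfy \<open>R (F k) = \<phi>\<^sup>k z\<^sub>i\<close>, so
  boundedness with constant \<open>C\<close> bounds the weighted \<open>L\<^sup>p\<close> norm of \<open>\<phi>\<^sup>k z\<^sub>i\<close> by a multiple of \<open>C\<^sup>k\<close>.
  If \<open>\<phi>\<close> exceeded \<open>E > C\<close> in modulus somewhere, it would do so on an open set, and these norms
  would grow at least like \<open>E\<^sup>k\<close>. Hence the bound on the operator itself bounds \<open>\<phi>\<close>.
\<close>

lemma besov_bounded_imp_bounded_symbol:
  fixes \<phi> :: "complex ^ 'n \<Rightarrow> complex" and p \<sigma> :: real
  assumes \<phi>: "mv_holomorphic_on \<phi> unit_ball" and p: "1 < p" and \<sigma>: "1 + \<sigma> > real CARD('n) / p"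
    and bd: "besov_bounded p \<sigma> (riemann_stieltjes \<phi>)"
  shows "\<exists>C. \<forall>z\<in>unit_ball. norm (\<phi> z) \<le> C"
proof -
  define \<alpha> where "\<alpha> = (1 + \<sigma>) * p - real CARD('n) - 1"
  have \<alpha>: "-1 < \<alpha>" using \<sigma> p by (simp add: \<alpha>_def field_simps)
  let ?T = "riemann_stieltjes \<phi>" and ?B = "unit_ball :: (complex ^ 'n) set"
  obtain C0 where maps: "\<And>f. f \<in> besov_space p \<sigma> \<Longrightarrow> ?T f \<in> besov_space p \<sigma>"
    and C0: "\<And>f. f \<in> besov_space p \<sigma> \<Longrightarrow> besov_norm p \<sigma> (?T f) \<le> C0 * besov_norm p \<sigma> f"
    using bd unfolding besov_bounded_def by blast
  \<comment> \<open>multiplication by the constant has to preserve inequalities when the bound is iterated\<close>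
  define C where "C = max C0 0"
  have C: "0 \<le> C" by (simp add: C_def)
  have norm_nonneg: "0 \<le> besov_norm p \<sigma> f" for f :: "complex ^ 'n \<Rightarrow> complex" by (simp add: besov_norm_def)
  have T_le: "besov_norm p \<sigma> (?T f) \<le> C * besov_norm p \<sigma> f" if "f \<in> besov_space p \<sigma>" for f
    using C0[OF that] mult_right_mono[OF max.cobounded1[of C0 0] norm_nonneg[of f]] by (simp add: C_def)
  define i :: 'n where "i = undefined"
  define F where "F = (\<lambda>k. (?T ^^ k) (\<lambda>z. z $ i))"
  have F_Suc: "F (Suc k) = ?T (F k)" for k by (simp add: F_def)
  obtain V where V: "emeasure lborel ?B = ennreal V" "0 < V"
    using unit_ball_vol_pos[of "DIM(complex ^ 'n)"] by (simp add: emeasure_ball)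
  have F0: "F 0 \<in> besov_space p \<sigma>"
  proof -
    have hol: "mv_holomorphic_on (F 0) unit_ball" by (simp add: F_def mv_holomorphic_component)
    have "complex_gradient (F 0) z = axis i 1" for z
      by (simp add: F_def complex_gradient_def partial_deriv_component vec_eq_iff axis_def)
    then have "gradient_energy \<alpha> p (F 0) = (\<integral>\<^sup>+z. indicator ?B z * ennreal ((1 - (norm z)\<^sup>2) powr \<alpha>) \<partial>lborel)"
      by (simp add: gradient_energy_def norm_axis_1)
    also have "\<dots> \<le> (\<integral>\<^sup>+z. ennreal (2 powr \<bar>\<alpha>\<bar>) * (indicator ?B z * ennreal ((1 - norm z) powr \<alpha>)) \<partial>lborel)"
    proof (rule nn_integral_mono)
      fix z :: "complex ^ 'n"
      show "indicator ?B z * ennreal ((1 - (norm z)\<^sup>2) powr \<alpha>) \<le> ennreal (2 powr \<bar>\<alpha>\<bar>) * (indicator ?B z * ennreal ((1 - norm z) powr \<alpha>))"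
        using ennreal_leI[OF weight_comparable(2)[of z \<alpha>]] by (cases "norm z < 1") (auto simp: ennreal_mult)
    qed
    also have "\<dots> = ennreal (2 powr \<bar>\<alpha>\<bar>) * (\<integral>\<^sup>+z. indicator ?B z * ennreal ((1 - norm z) powr \<alpha>) \<partial>lborel)"
    proof (rule nn_integral_cmult)
      have "?B \<in> sets borel" by simp
      then show "(\<lambda>z. indicator ?B z * ennreal ((1 - norm z) powr \<alpha>)) \<in> borel_measurable lborel" by measurable
    qed
    also have "\<dots> < \<infinity>"
      using weight_nn_integral_finite[OF \<alpha>, where 'a="complex ^ 'n"] by (simp add: ennreal_mult_less_top)
    finally have "gradient_energy \<alpha> p (F 0) / ennreal V < \<infinity>"
      using V(2) by (simp add: divide_ennreal_def inverse_ennreal ennreal_mult_less_top)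
    then show ?thesis
      using hol by (simp add: besov_space_def besov_pow_eq[OF hol p] \<alpha>_def V(1))
  qed
  have F: "F k \<in> besov_space p \<sigma> \<and> besov_norm p \<sigma> (F k) \<le> C ^ k * besov_norm p \<sigma> (F 0)" for k
  proof (induction k)
    case (Suc k)
    have "besov_norm p \<sigma> (F (Suc k)) \<le> C * besov_norm p \<sigma> (F k)" unfolding F_Suc using Suc T_le by blast
    also have "\<dots> \<le> C * (C ^ k * besov_norm p \<sigma> (F 0))" using Suc C by (intro mult_left_mono) auto
    finally show ?case using maps Suc by (simp add: F_Suc mult.assoc)
  qed (simp add: F0)
  have F_hol: "mv_holomorphic_on (F k) unit_ball" for k using F[of k] by (simp add: besov_space_def)
  have radial: "radial_deriv (F k) z = \<phi> z ^ k * z $ i" if "z \<in> unit_ball" for k z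
  proof (induction k)
    case 0
    have "radial_deriv (F 0) z = (\<Sum>j\<in>UNIV. z $ j * axis j 1 $ i)"
      by (simp add: F_def radial_deriv_def partial_deriv_component)
    also have "\<dots> = (\<Sum>j\<in>UNIV. axis i 1 $ j * z $ j)"
      by (rule sum.cong) (auto simp: axis_def)
    finally show ?case by (simp add: sum_axis)
  next
    case (Suc k)
    then show ?case
      unfolding F_Suc radial_deriv_riemann_stieltjes[OF \<phi> F_hol that] by simp
  qed
  define D where "D = V * besov_norm p \<sigma> (F 0) powr p"
  have D: "0 \<le> D" using V by (simp add: D_def)
  have energy: "gradient_energy \<alpha> p (F k) \<le> ennreal (D * (C powr p) ^ k)" for k
  proof -
    have fin: "besov_pow p \<sigma> (F k) < \<infinity>" using F[of k] by (simp add: besov_space_def)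
    have "besov_norm p \<sigma> (F k) powr p = enn2real (besov_pow p \<sigma> (F k))"
      using p by (simp add: besov_norm_def powr_powr)
    then have "besov_pow p \<sigma> (F k) = ennreal (besov_norm p \<sigma> (F k) powr p)" using fin by simp
    also have "\<dots> \<le> ennreal ((C ^ k * besov_norm p \<sigma> (F 0)) powr p)"
      using F[of k] norm_nonneg p by (intro ennreal_leI powr_mono2) auto
    also have "(C ^ k * besov_norm p \<sigma> (F 0)) powr p = besov_norm p \<sigma> (F 0) powr p * (C powr p) ^ k"
      using C norm_nonneg by (simp add: powr_mult powr_of_power mult.commute)
    finally have pow: "besov_pow p \<sigma> (F k) \<le> ennreal (besov_norm p \<sigma> (F 0) powr p * (C powr p) ^ k)" .
    have "gradient_energy \<alpha> p (F k) = ennreal V * (gradient_energy \<alpha> p (F k) / ennreal V)"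
      using V(2) by (simp add: ennreal_times_divide mult.commute[of "ennreal V"] ennreal_mult_divide_eq)
    also have "\<dots> \<le> ennreal V * besov_pow p \<sigma> (F k)"
      unfolding besov_pow_eq[OF F_hol p] \<alpha>_def V(1) by (intro mult_left_mono) auto
    also have "\<dots> \<le> ennreal V * ennreal (besov_norm p \<sigma> (F 0) powr p * (C powr p) ^ k)"
      by (intro mult_left_mono pow) auto
    finally show ?thesis using V by (simp add: D_def ennreal_mult[symmetric] mult.assoc)
  qed
  have "norm (\<phi> z0) \<le> C" if z0: "z0 \<in> unit_ball" for z0
  proof (rule ccontr)
    assume "\<not> norm (\<phi> z0) \<le> C"
    then obtain E where E: "C < E" "E < norm (\<phi> z0)" using dense[of C "norm (\<phi> z0)"] by auto
    have "open {z \<in> ?B. E < norm (\<phi> z)}"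
    proof -
      have "continuous_on ?B (\<lambda>z. norm (\<phi> z))"
        by (intro continuous_intros mv_holomorphic_imp_continuous_on[OF \<phi>])
      then have "open (?B \<inter> (\<lambda>z. norm (\<phi> z)) -` {E<..})"
        by (rule continuous_open_preimage) auto
      moreover have "{z \<in> ?B. E < norm (\<phi> z)} = ?B \<inter> (\<lambda>z. norm (\<phi> z)) -` {E<..}" by auto
      ultimately show ?thesis by (simp only:)
    qed
    moreover have "z0 \<in> {z \<in> ?B. E < norm (\<phi> z)}" using z0 E by simp
    ultimately obtain r where r: "0 < r" "ball z0 r \<subseteq> {z \<in> ?B. E < norm (\<phi> z)}" using openE by blast
    \<comment> \<open>the zeros of \<open>z $ i\<close> are removed so that the test integrand is positive on the whole of \<open>S\<close>\<close>
    define S where "S = ball z0 r \<inter> {z. z $ i \<noteq> 0}"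
    have "open S" unfolding S_def
      by (intro open_Int open_ball open_Collect_neq continuous_intros)
    have "S \<noteq> {}"
    proof (cases "z0 $ i = 0")
      case True
      have "z0 + of_real (r / 2) *s axis i 1 \<in> S"
        using r True by (simp add: S_def dist_norm norm_scale_vec norm_axis_1)
      then show ?thesis by blast
    next
      case False
      then have "z0 \<in> S" using r by (simp add: S_def)
      then show ?thesis by blast
    qed
    then obtain z1 \<rho> where \<rho>: "0 < \<rho>" "ball z1 \<rho> \<subseteq> S" using \<open>open S\<close> openE by blast
    define g where "g = (\<lambda>z. indicator S z * ennreal (norm (z $ i) powr p * (1 - (norm z)\<^sup>2) powr \<alpha>))"
    have S_B: "S \<subseteq> ?B" and S_E: "\<And>z. z \<in> S \<Longrightarrow> E < norm (\<phi> z)" using r by (auto simp: S_def)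
    have g_meas: "g \<in> borel_measurable lborel"
    proof -
      have "continuous_on S (\<lambda>z. norm (z $ i) powr p * (1 - (norm z)\<^sup>2) powr \<alpha>)"
        by (intro continuous_on_mult continuous_on_subset[OF continuous_on_weight S_B] continuous_on_powr' continuous_intros)
           (use p in auto)
      then show ?thesis unfolding g_def measurable_lborel2
        using \<open>open S\<close> by (intro borel_measurable_indicator_mult_ennreal) auto
    qed
    have ineq: "ennreal ((E powr p) ^ k) * (\<integral>\<^sup>+z. g z \<partial>lborel) \<le> ennreal (D * (C powr p) ^ k)" for k
    proof -
      have "ennreal ((E powr p) ^ k) * (\<integral>\<^sup>+z. g z \<partial>lborel) = (\<integral>\<^sup>+z. ennreal ((E powr p) ^ k) * g z \<partial>lborel)"
        by (rule nn_integral_cmult[OF g_meas, symmetric])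
      also have "\<dots> \<le> gradient_energy \<alpha> p (F k)"
        unfolding gradient_energy_def
      proof (rule nn_integral_mono)
        fix z :: "complex ^ 'n"
        show "ennreal ((E powr p) ^ k) * g z \<le> indicator ?B z * ennreal (norm (complex_gradient (F k) z) powr p * (1 - (norm z)\<^sup>2) powr \<alpha>)"
        proof (cases "z \<in> S")
          case True
          then have z: "z \<in> ?B" using S_B by blast
          have "E ^ k * norm (z $ i) \<le> norm (radial_deriv (F k) z)"
            unfolding radial[OF z] norm_mult norm_power
            using S_E[OF True] C E by (intro mult_right_mono power_mono) auto
          also have "\<dots> \<le> norm (complex_gradient (F k) z)"
            using z by (intro norm_radial_deriv_le) auto
          finally have "(E ^ k * norm (z $ i)) powr p \<le> norm (complex_gradient (F k) z) powr p"
            using C E p by (intro powr_mono2) auto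
          moreover have "(E ^ k * norm (z $ i)) powr p = (E powr p) ^ k * norm (z $ i) powr p"
            using C E by (simp add: powr_mult powr_of_power mult.commute)
          ultimately have "((E powr p) ^ k * norm (z $ i) powr p) * (1 - (norm z)\<^sup>2) powr \<alpha>
            \<le> norm (complex_gradient (F k) z) powr p * (1 - (norm z)\<^sup>2) powr \<alpha>"
            by (intro mult_right_mono) auto
          then show ?thesis using True z
            by (simp add: g_def ennreal_mult[symmetric] mult.assoc ennreal_leI)
        qed (simp add: g_def)
      qed
      also note energy
      finally show ?thesis .
    qed
    have "(\<integral>\<^sup>+z. g z \<partial>lborel) \<noteq> 0"
    proof
      assume "(\<integral>\<^sup>+z. g z \<partial>lborel) = 0"
      then have "AE z in lborel. g z = 0" using nn_integral_0_iff_AE[OF g_meas] by blast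
      moreover have "g z \<noteq> 0" if "z \<in> ball z1 \<rho>" for z
      proof -
        have "z \<in> S" "z \<in> ?B" using that \<rho> S_B by blast+
        then have "(norm z)\<^sup>2 < 1" "z $ i \<noteq> 0" using norm_square_less_1[of z] by (auto simp: S_def)
        then show ?thesis using \<open>z \<in> S\<close> by (simp add: g_def)
      qed
      ultimately have "AE z in lborel. z \<notin> ball z1 \<rho>" by (auto elim: eventually_mono)
      then have "emeasure lborel (ball z1 \<rho>) = 0"
        by (subst (asm) AE_iff_measurable[of "ball z1 \<rho>"]) auto
      then show False using \<rho> unit_ball_vol_pos[of "DIM(complex ^ 'n)"] by (simp add: emeasure_ball)
    qed
    moreover have "(\<integral>\<^sup>+z. g z \<partial>lborel) \<noteq> \<infinity>" using ineq[of 0] by (auto simp: top_unique)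
    ultimately obtain a where a: "(\<integral>\<^sup>+z. g z \<partial>lborel) = ennreal a" "0 < a"
      by (cases "\<integral>\<^sup>+z. g z \<partial>lborel") auto
    define x where "x = C powr p / E powr p"
    have Ep: "C powr p < E powr p" using C E p by (intro powr_less_mono2) auto
    then have E0: "0 < E powr p" using powr_ge_zero[of C p] by linarith
    then have x: "x < 1" using Ep by (simp add: x_def)
    have ax: "a \<le> D * x ^ k" for k
    proof -
      have "(E powr p) ^ k * a \<le> D * (C powr p) ^ k"
        using ineq[of k] a D by (simp add: ennreal_mult[symmetric])
      then show ?thesis using E0 by (simp add: x_def power_divide field_simps)
    qed
    obtain k where "x ^ k < a / (D + 1)" using real_arch_pow_inv[OF _ x, of "a / (D + 1)"] a D by auto
    then have "D * x ^ k \<le> D * (a / (D + 1))" using D by (intro mult_left_mono) auto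
    also have "\<dots> < a" using a D by (simp add: field_simps)
    finally show False using ax[of k] by simp
  qed
  then show ?thesis by blast
qed

theorem theorem3p1:
  fixes \<phi> :: "complex ^ 'n \<Rightarrow> complex" and p \<sigma> :: real
  assumes "CARD('n) > 1"
    and "mv_holomorphic_on \<phi> unit_ball"
    and "1 < p" and "0 \<le> \<sigma>" and "1 + \<sigma> > real CARD('n) / p"
  shows "besov_bounded p \<sigma> (riemann_stieltjes \<phi>) \<longleftrightarrow> Hinf_norm \<phi> < \<infinity>"
proof
  assume "besov_bounded p \<sigma> (riemann_stieltjes \<phi>)"
  from besov_bounded_imp_bounded_symbol[OF assms(2,3,5) this]
  obtain C where "\<And>z. z \<in> unit_ball \<Longrightarrow> norm (\<phi> z) \<le> C" by blast
  then have "Hinf_norm \<phi> \<le> ennreal C"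
    unfolding Hinf_norm_def by (intro SUP_least ennreal_leI)
  also have "\<dots> < \<infinity>" by simp
  finally show "Hinf_norm \<phi> < \<infinity>" .
next
  assume "Hinf_norm \<phi> < \<infinity>"
  then show "besov_bounded p \<sigma> (riemann_stieltjes \<phi>)"
    by (rule Hinf_norm_finite_imp_besov_bounded[OF assms(2,3,5)])
qed

end
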